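(* Let $X$ be a Hilbert $C^*$-module over a $C^*$-algebra $B$, let $M,N\subset X$ be complemented submodules, and let $\pi:B\to\mathbb{B}(H_\pi)$ be a faithful representation. Then: 1. if $(M,N)$ is concordant, then $c_\pi(M,N)=c(M,N)$, where $c(M,N):=\|P_MP_N-P_{M\cap N}\|$; 2. if $(M,N)$ is discordant, then $c_\pi(M,N)=1$. In particular, $c_\pi(M,N)$ is independent of the choice of faithful representation $\pi$.
   Context: A closed submodule $\Omega\subset X$ is complemented if $X=\Omega\oplus\Omega^\perp$, where $\Omega^\perp=\{x\in X:\langle x,y\rangle=0\ \forall y\in\Omega\}$; then $P_\Omega$ denotes the adjointable orthogonal projection of $X$ onto $\Omega$. The pair $(M,N)$ is concordant if $X=(M\cap N)\oplus\overline{(M^\perp+N^\perp)}$ (in particular $M\cap N$ is then complemented, so $P_{M\cap N}$ exists), and discordant otherwise. For a representation $\pi:B\to\mathbb{B}(H_\pi)$ on a Hilbert space, $X_\pi:=X\otimes_B H_\pi$ is the Hilbert space given by the interior tensor product, and for a closed submodule $\Omega\subset X$, $\Omega_\pi:=\Omega\otimes_BH_\pi$ is regarded as a closed subspace of $X_\pi$ (the closed linear span of $\{x\otimes h:x\in\Omega,h\in H_\pi\}$). The (cosine of the) local Friedrichs angle at $\pi$ is $c_\pi(M,N):=\|P_{M_\pi}P_{N_\pi}-P_{M_\pi\cap N_\pi}\|$, with $P_V\in\mathbb{B}(X_\pi)$ the orthogonal projection onto the closed subspace $V$ of the Hilbert space $X_\pi$. *)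

theory Defs
  imports "HOL-Analysis.Analysis" "HOL-Library.Set_Algebras"
begin

section \<open>Complex normed spaces and Hilbert spaces\<close>

class scaleC = scaleR +
  fixes scaleC :: "complex \<Rightarrow> 'a \<Rightarrow> 'a"  (infixr \<open>*\<^sub>C\<close> 75)
  assumes scaleR_scaleC: "r *\<^sub>R x = complex_of_real r *\<^sub>C x"

class complex_vector = scaleC + real_vector +
  assumes scaleC_add_right: "a *\<^sub>C (x + y) = a *\<^sub>C x + a *\<^sub>C y"
    and scaleC_add_left: "(a + b) *\<^sub>C x = a *\<^sub>C x + b *\<^sub>C x"
    and scaleC_scaleC: "a *\<^sub>C (b *\<^sub>C x) = (a * b) *\<^sub>C x"
    and scaleC_one: "1 *\<^sub>C x = x"

global_interpretation complex_vector: vector_space "scaleC :: complex \<Rightarrow> 'a \<Rightarrow> 'a::complex_vector"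
  defines csubspace = complex_vector.subspace
    and cspan = complex_vector.span
  by unfold_locales
    (simp_all add: scaleC_add_right scaleC_add_left scaleC_scaleC scaleC_one)

class complex_normed_vector = complex_vector + real_normed_vector +
  assumes norm_scaleC: "norm (a *\<^sub>C x) = cmod a * norm x"

text \<open>Inner products are linear in the second argument, for Hilbert spaces as well as for
  Hilbert modules.\<close>

class chilbert_space = complex_normed_vector + banach +
  fixes cinner :: "'a \<Rightarrow> 'a \<Rightarrow> complex"
  assumes cinner_add_right: "cinner x (y + z) = cinner x y + cinner x z"
    and cinner_scaleC_right: "cinner x (a *\<^sub>C y) = a * cinner x y"
    and cinner_commute: "cnj (cinner x y) = cinner y x"
    and cinner_self: "cinner x x = complex_of_real ((norm x)\<^sup>2)"


section \<open>C*-algebras and Hilbert C*-modules\<close>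

text \<open>No unit is required.\<close>

class cstar_algebra = complex_normed_vector + real_normed_algebra + banach +
  fixes adj :: "'a \<Rightarrow> 'a"
  assumes scaleC_mult_left: "(a *\<^sub>C x) * y = a *\<^sub>C (x * y)"
    and scaleC_mult_right: "x * (a *\<^sub>C y) = a *\<^sub>C (x * y)"
    and adj_adj: "adj (adj x) = x"
    and adj_add: "adj (x + y) = adj x + adj y"
    and adj_scaleC: "adj (a *\<^sub>C x) = cnj a *\<^sub>C adj x"
    and adj_mult: "adj (x * y) = adj y * adj x"
    and cstar_identity: "norm (adj x * x) = (norm x)\<^sup>2"

definition cstar_positive :: "'b::cstar_algebra \<Rightarrow> bool" where
  "cstar_positive a \<longleftrightarrow> (\<exists>c. a = adj c * c)"

text \<open>\<open>act\<close> is the right action of the C*-algebra and \<open>ip\<close> the algebra-valued inner product.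
  Definiteness of \<open>ip\<close> and completeness in the module norm are contained in \<open>norm_ip\<close> and the
  class \<open>banach\<close>.\<close>

locale hilbert_cstar_module =
  fixes act :: "'x::{complex_normed_vector,banach} \<Rightarrow> 'b::cstar_algebra \<Rightarrow> 'x"
    and ip :: "'x \<Rightarrow> 'x \<Rightarrow> 'b"
  assumes act_add_left: "act (x + y) b = act x b + act y b"
    and act_add_right: "act x (a + b) = act x a + act x b"
    and act_mult: "act x (a * b) = act (act x a) b"
    and act_scaleC_left: "act (c *\<^sub>C x) b = c *\<^sub>C act x b"
    and act_scaleC_right: "act x (c *\<^sub>C b) = c *\<^sub>C act x b"
    and ip_add_right: "ip x (y + z) = ip x y + ip x z"
    and ip_scaleC_right: "ip x (c *\<^sub>C y) = c *\<^sub>C ip x y"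
    and ip_act_right: "ip x (act y b) = ip x y * b"
    and ip_adj: "adj (ip x y) = ip y x"
    and ip_self_positive: "cstar_positive (ip x x)"
    and norm_ip: "norm x = sqrt (norm (ip x x))"


section \<open>Complemented submodules, projections and the Friedrichs angle\<close>

text \<open>The notions with an argument \<open>ip\<close> that do not mention \<open>act\<close> are used both for the
  algebra-valued inner product of a Hilbert module and for \<open>cinner\<close> on a Hilbert space.\<close>

definition ortho_compl :: "('v \<Rightarrow> 'v \<Rightarrow> 'c::zero) \<Rightarrow> 'v set \<Rightarrow> 'v set" where
  "ortho_compl ip S = {x. \<forall>y\<in>S. ip x y = 0}"

definition whole_direct_sum :: "'v::ab_group_add set \<Rightarrow> 'v set \<Rightarrow> bool" where
  "whole_direct_sum U V \<longleftrightarrow> U + V = UNIV \<and> U \<inter> V = {0}"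

definition closed_submodule ::
  "('x::complex_normed_vector \<Rightarrow> 'b \<Rightarrow> 'x) \<Rightarrow> 'x set \<Rightarrow> bool" where
  "closed_submodule act S \<longleftrightarrow> closed S \<and> csubspace S \<and> (\<forall>x\<in>S. \<forall>b. act x b \<in> S)"

definition complemented_submodule ::
  "('x::complex_normed_vector \<Rightarrow> 'b \<Rightarrow> 'x) \<Rightarrow> ('x \<Rightarrow> 'x \<Rightarrow> 'b::zero) \<Rightarrow> 'x set \<Rightarrow> bool" where
  "complemented_submodule act ip S \<longleftrightarrow>
     closed_submodule act S \<and> whole_direct_sum S (ortho_compl ip S)"

text \<open>Meaningful only if every vector splits along \<open>S\<close> and its orthogonal complement: for
  complemented submodules, and for closed subspaces of Hilbert spaces.\<close>

definition ortho_proj :: "('v::ab_group_add \<Rightarrow> 'v \<Rightarrow> 'c::zero) \<Rightarrow> 'v set \<Rightarrow> 'v \<Rightarrow> 'v" where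
  "ortho_proj ip S x = (THE u. u \<in> S \<and> x - u \<in> ortho_compl ip S)"

definition concordant :: "('x::complex_normed_vector \<Rightarrow> 'x \<Rightarrow> 'c::zero) \<Rightarrow> 'x set \<Rightarrow> 'x set \<Rightarrow> bool" where
  "concordant ip M N \<longleftrightarrow>
     whole_direct_sum (M \<inter> N) (closure (ortho_compl ip M + ortho_compl ip N))"

abbreviation discordant :: "('x::complex_normed_vector \<Rightarrow> 'x \<Rightarrow> 'c::zero) \<Rightarrow> 'x set \<Rightarrow> 'x set \<Rightarrow> bool" where
  "discordant ip M N \<equiv> \<not> concordant ip M N"

definition friedrichs_cos :: "('v::real_normed_vector \<Rightarrow> 'v \<Rightarrow> 'c::zero) \<Rightarrow> 'v set \<Rightarrow> 'v set \<Rightarrow> real" where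
  "friedrichs_cos ip M N =
     onorm (\<lambda>x. ortho_proj ip M (ortho_proj ip N x) - ortho_proj ip (M \<inter> N) x)"


section \<open>Representations and localization\<close>

locale cstar_representation =
  fixes \<pi> :: "'b::cstar_algebra \<Rightarrow> 'h::chilbert_space \<Rightarrow> 'h"
  assumes rep_bounded: "bounded_linear (\<pi> b)"
    and rep_clinear: "\<pi> b (c *\<^sub>C h) = c *\<^sub>C \<pi> b h"
    and rep_add: "\<pi> (a + b) h = \<pi> a h + \<pi> b h"
    and rep_scaleC: "\<pi> (c *\<^sub>C b) h = c *\<^sub>C \<pi> b h"
    and rep_mult: "\<pi> (a * b) h = \<pi> a (\<pi> b h)"
    and rep_adj: "cinner (\<pi> (adj b) h) k = cinner h (\<pi> b k)"

locale faithful_representation = cstar_representation +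
  assumes rep_inj: "inj \<pi>"

text \<open>The Hilbert space \<open>'k\<close>, with \<open>tens x h\<close> in the role of the elementary tensor of \<open>x\<close> and \<open>h\<close>,
  is the interior tensor product: the Hausdorff completion of the algebraic tensor product balanced
  over the algebra, with respect to the semi-inner product determined by \<open>tens_inner\<close>. A
  type cannot depend on the term \<open>\<pi>\<close>, so the completion is specified by its canonical map, which
  determines it up to a unique unitary compatible with elementary tensors.\<close>

locale interior_tensor_product =
  hilbert_cstar_module act ip + cstar_representation \<pi>
  for act :: "'x::{complex_normed_vector,banach} \<Rightarrow> 'b::cstar_algebra \<Rightarrow> 'x"
    and ip :: "'x \<Rightarrow> 'x \<Rightarrow> 'b"
    and \<pi> :: "'b \<Rightarrow> 'h::chilbert_space \<Rightarrow> 'h" +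
  fixes tens :: "'x \<Rightarrow> 'h \<Rightarrow> 'k::chilbert_space"
  assumes tens_add_left: "tens (x + y) h = tens x h + tens y h"
    and tens_add_right: "tens x (h + k) = tens x h + tens x k"
    and tens_scaleC_left: "tens (c *\<^sub>C x) h = c *\<^sub>C tens x h"
    and tens_scaleC_right: "tens x (c *\<^sub>C h) = c *\<^sub>C tens x h"
    and tens_balanced: "tens (act x b) h = tens x (\<pi> b h)"
    and tens_inner: "cinner (tens x h) (tens y k) = cinner h (\<pi> (ip x y) k)"
    and tens_dense: "closure (cspan {tens x h | x h. True}) = UNIV"

definition localized :: "('x \<Rightarrow> 'h \<Rightarrow> 'k::chilbert_space) \<Rightarrow> 'x set \<Rightarrow> 'k set" where
  "localized tens S = closure (cspan {tens x h | x h. x \<in> S})"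

definition local_friedrichs_cos ::
  "('x \<Rightarrow> 'h \<Rightarrow> 'k::chilbert_space) \<Rightarrow> 'x set \<Rightarrow> 'x set \<Rightarrow> real" where
  "local_friedrichs_cos tens M N = friedrichs_cos cinner (localized tens M) (localized tens N)"

end

theory Submission
  imports Defs
begin

text \<open>Elementary tensors recover the module norm, \<open>\<parallel>x\<parallel> = sup {\<parallel>x \<otimes> h\<parallel> | \<parallel>h\<parallel> \<le> 1}\<close>,
  because \<open>\<pi>\<close> is isometric, and \<open>P\<^sub>M\<^sub>\<pi>\<close> acts on them through \<open>P\<^sub>M\<close>. Hence an adjointable operator
  has at most the norm of its amplification to \<open>X\<^sub>\<pi>\<close>; the reverse inequality holds because the powers
  of \<open>T\<^sup>*T\<close> applied to a finite sum of elementary tensors grow at most like \<open>\<parallel>T\<parallel>\<^sup>2\<^sup>n\<close>. For a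
  concordant pair \<open>P\<^sub>M P\<^sub>N - P\<^sub>M\<^sub>\<inter>\<^sub>N\<close> amplifies to its local counterpart, so the two cosines agree.
  If a local cosine is less than \<open>1\<close>, the powers of \<open>P\<^sub>N P\<^sub>M P\<^sub>N\<close> converge, first on \<open>X\<^sub>\<pi>\<close> and then on
  \<open>X\<close>, and splitting every \<open>x\<close> along the limit shows concordance.

  That an injective representation is isometric is proved without spectral theory, from square roots
  obtained by a norm-convergent iteration.\<close>

section \<open>Orthogonal projections\<close>

lemma scaleC_simps [simp]:
  fixes x :: "'a::complex_vector"
  shows "0 *\<^sub>C x = 0" "c *\<^sub>C (0::'a) = 0" "1 *\<^sub>C x = x" "(- c) *\<^sub>C x = - (c *\<^sub>C x)"
    "c *\<^sub>C (- x) = - (c *\<^sub>C x)"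
  using scaleC_one by auto

lemma scaleC_diff_right: "c *\<^sub>C (x - y) = c *\<^sub>C x - c *\<^sub>C (y::'a::complex_vector)"
  by (rule complex_vector.scale_right_diff_distrib)

lemma csubspace_closure:
  fixes S :: "'a::complex_normed_vector set"
  assumes "csubspace S"
  shows "csubspace (closure S)"
proof -
  have cont: "continuous_on A (\<lambda>x::'a. c *\<^sub>C x)" for A and c :: complex
  proof (rule bounded_linear.continuous_on[OF _ continuous_on_id])
    show "bounded_linear (\<lambda>x::'a. c *\<^sub>C x)"
      by (rule bounded_linear_intro[where K = "cmod c"])
        (simp_all add: scaleC_add_right scaleR_scaleC scaleC_scaleC mult.commute norm_scaleC)
  qed
  show ?thesis
    unfolding complex_vector.subspace_def
  proof (intro conjI ballI allI)
    show "0 \<in> closure S"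
      using assms closure_subset complex_vector.subspace_0 by blast
  next
    fix x y assume "x \<in> closure S" "y \<in> closure S"
    then obtain f g where f: "\<And>n. f n \<in> S" "f \<longlonglongrightarrow> x" and g: "\<And>n. g n \<in> S" "g \<longlonglongrightarrow> y"
      unfolding closure_sequential by blast
    then have "\<And>n. f n + g n \<in> S" "(\<lambda>n. f n + g n) \<longlonglongrightarrow> x + y"
      using assms by (auto intro: tendsto_add complex_vector.subspace_add)
    then show "x + y \<in> closure S"
      unfolding closure_sequential by (intro exI[of _ "\<lambda>n. f n + g n"]) simp
  next
    fix c :: complex and x assume "x \<in> closure S"
    then have "c *\<^sub>C x \<in> closure ((\<lambda>x. c *\<^sub>C x) ` S)"
      using continuous_image_closure_subset[OF cont[of "closure S"] subset_refl] closure_mono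
        image_closure_subset[OF cont closed_closure closure_subset] by blast
    moreover have "(\<lambda>x. c *\<^sub>C x) ` S \<subseteq> S"
      using assms complex_vector.subspace_scale by blast
    ultimately show "c *\<^sub>C x \<in> closure S" using closure_mono by blast
  qed
qed

text \<open>Serves both the algebra-valued form on \<open>X\<close> and \<open>cinner\<close> on a
  Hilbert space. The codomain is only an additive group, so homogeneity is required merely for
  vanishing: that much keeps orthogonal complements complex subspaces.\<close>

locale definite_form =
  fixes ip :: "'v::complex_vector \<Rightarrow> 'v \<Rightarrow> 'c::ab_group_add"
  assumes form_add_left: "ip (x + y) z = ip x z + ip y z"
    and form_add_right: "ip x (y + z) = ip x y + ip x z"
    and form_scaleC_zero: "ip x y = 0 \<Longrightarrow> ip (c *\<^sub>C x) y = 0"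
    and form_zero_commute: "ip x y = 0 \<Longrightarrow> ip y x = 0"
    and form_definite: "ip x x = 0 \<Longrightarrow> x = 0"
begin

lemma form_zero [simp]: "ip 0 x = 0" "ip x 0 = 0"
  using form_add_left[of 0 0 x] form_add_right[of x 0 0] by auto

lemma form_diff_left: "ip (x - y) z = ip x z - ip y z"
  using form_add_left[of "x - y" y z] by simp

lemma form_diff_right: "ip z (x - y) = ip z x - ip z y"
  using form_add_right[of z "x - y" y] by simp

lemma csubspace_ortho_compl: "csubspace (ortho_compl ip S)"
  by (simp add: complex_vector.subspace_def ortho_compl_def form_add_left form_scaleC_zero)

context
  fixes S
  assumes subspace: "csubspace S" and decomposes: "S + ortho_compl ip S = UNIV"
begin

lemma ortho_proj_eqI:
  assumes "u \<in> S" "x - u \<in> ortho_compl ip S"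
  shows "ortho_proj ip S x = u"
  unfolding ortho_proj_def
proof (rule the_equality)
  fix v assume v: "v \<in> S \<and> x - v \<in> ortho_compl ip S"
  \<comment> \<open>Two candidates differ by an element of \<open>S\<close> that is also orthogonal
    to \<open>S\<close>.\<close>
  then have "(x - u) - (x - v) \<in> ortho_compl ip S" "v - u \<in> S"
    using v assms by (simp_all only: complex_vector.subspace_diff[OF csubspace_ortho_compl]
        complex_vector.subspace_diff[OF subspace])
  then have "ip (v - u) (v - u) = 0" by (simp add: ortho_compl_def)
  then show "v = u" using form_definite by force
qed (use assms in simp)

lemma
  shows ortho_proj_in: "ortho_proj ip S x \<in> S"
    and ortho_proj_compl: "x - ortho_proj ip S x \<in> ortho_compl ip S"
proof -
  have "x \<in> S + ortho_compl ip S" by (simp add: decomposes)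
  then obtain u v where "u \<in> S" "v \<in> ortho_compl ip S" "x = u + v"
    by (rule set_plus_elim)
  moreover from this have "ortho_proj ip S x = u" by (intro ortho_proj_eqI) auto
  ultimately show "ortho_proj ip S x \<in> S" "x - ortho_proj ip S x \<in> ortho_compl ip S" by auto
qed

lemma ortho_proj_idem: "x \<in> S \<Longrightarrow> ortho_proj ip S x = x"
  by (rule ortho_proj_eqI) (simp_all add: ortho_compl_def)

lemma ortho_proj_add: "ortho_proj ip S (x + y) = ortho_proj ip S x + ortho_proj ip S y"
proof (rule ortho_proj_eqI)
  show "ortho_proj ip S x + ortho_proj ip S y \<in> S"
    by (intro complex_vector.subspace_add[OF subspace] ortho_proj_in)
  have "x + y - (ortho_proj ip S x + ortho_proj ip S y)
      = (x - ortho_proj ip S x) + (y - ortho_proj ip S y)" by simp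
  then show "x + y - (ortho_proj ip S x + ortho_proj ip S y) \<in> ortho_compl ip S"
    by (metis complex_vector.subspace_add[OF csubspace_ortho_compl] ortho_proj_compl)
qed

lemma ortho_proj_scaleC: "ortho_proj ip S (c *\<^sub>C x) = c *\<^sub>C ortho_proj ip S x"
proof (rule ortho_proj_eqI)
  show "c *\<^sub>C ortho_proj ip S x \<in> S"
    by (intro complex_vector.subspace_scale[OF subspace] ortho_proj_in)
  show "c *\<^sub>C x - c *\<^sub>C ortho_proj ip S x \<in> ortho_compl ip S"
    unfolding scaleC_diff_right[symmetric]
    by (intro complex_vector.subspace_scale[OF csubspace_ortho_compl] ortho_proj_compl)
qed

lemma ortho_proj_diff: "ortho_proj ip S (x - y) = ortho_proj ip S x - ortho_proj ip S y"
  using ortho_proj_add[of "x - y" y] by simp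

lemma ortho_proj_self_adjoint: "ip (ortho_proj ip S x) y = ip x (ortho_proj ip S y)"
proof -
  have "ip (x - ortho_proj ip S x) (ortho_proj ip S y) = 0"
    using ortho_proj_compl ortho_proj_in by (auto simp: ortho_compl_def)
  moreover have "ip (ortho_proj ip S x) (y - ortho_proj ip S y) = 0"
    using ortho_proj_compl ortho_proj_in by (auto simp: ortho_compl_def intro: form_zero_commute)
  ultimately show ?thesis by (simp add: form_diff_left form_diff_right)
qed

end

end

section \<open>Geometry of complex Hilbert spaces\<close>

lemma cinner_add_left: "cinner (x + y) z = cinner x z + cinner y z"
  by (metis cinner_add_right cinner_commute complex_cnj_add)

lemma cinner_scaleC_left: "cinner (c *\<^sub>C x) y = cnj c * cinner x y"
  by (metis cinner_commute cinner_scaleC_right complex_cnj_mult)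

global_interpretation cinner: definite_form "cinner :: 'k \<Rightarrow> 'k \<Rightarrow> complex"
  for dummy :: "'k::chilbert_space itself"
proof
  fix x y :: 'k
  show "cinner x y = 0 \<Longrightarrow> cinner y x = 0"
    by (metis cinner_commute complex_cnj_zero)
qed (auto simp: cinner_add_left cinner_add_right cinner_scaleC_left cinner_self)

lemma Re_cinner_self: "Re (cinner x x) = (norm x)\<^sup>2"
  by (simp add: cinner_self)

lemma Re_cinner_commute: "Re (cinner y x) = Re (cinner x y)"
  by (metis cinner_commute cnj.sel(1))

lemma norm_add_sqr:
  fixes x y :: "'a::chilbert_space"
  shows "(norm (x + y))\<^sup>2 = (norm x)\<^sup>2 + 2 * Re (cinner x y) + (norm y)\<^sup>2"
  unfolding Re_cinner_self[symmetric]
  by (simp add: cinner_add_left cinner_add_right Re_cinner_commute[of x y])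

lemma norm_diff_sqr:
  fixes x y :: "'a::chilbert_space"
  shows "(norm (x - y))\<^sup>2 = (norm x)\<^sup>2 - 2 * Re (cinner x y) + (norm y)\<^sup>2"
  unfolding Re_cinner_self[symmetric]
  by (simp add: cinner.form_diff_left cinner.form_diff_right Re_cinner_commute[of x y])

lemma cinner_cauchy_schwarz: "cmod (cinner x y) \<le> norm x * norm y"
proof (cases "x = 0")
  case False
  \<comment> \<open>\<open>t\<close> is the coefficient of the projection of \<open>y\<close> onto
    the line through \<open>x\<close>; the remainder has nonnegative squared norm.\<close>
  define t where "t = cinner x y / (norm x)\<^sup>2"
  have "(norm y)\<^sup>2 - (cmod (cinner x y))\<^sup>2 / (norm x)\<^sup>2 = Re (cinner (y - t *\<^sub>C x) (y - t *\<^sub>C x))"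
  proof -
    have "cinner (y - t *\<^sub>C x) (y - t *\<^sub>C x)
        = cinner y y - t * cnj (cinner x y) - cnj t * cinner x y + t * cnj t * cinner x x"
      by (simp add: cinner.form_diff_left cinner.form_diff_right cinner_scaleC_left
          cinner_scaleC_right cinner_commute[symmetric, of x y] algebra_simps)
    also have "\<dots> = cinner y y - (cinner x y * cnj (cinner x y)) / (norm x)\<^sup>2"
      using False by (simp add: t_def cinner_self field_simps power2_eq_square)
    also have "Re \<dots> = (norm y)\<^sup>2 - (cmod (cinner x y))\<^sup>2 / (norm x)\<^sup>2"
      by (simp add: cinner_self complex_norm_square[symmetric] flip: of_real_power of_real_divide)
    finally show ?thesis by simp
  qed
  also have "\<dots> \<ge> 0" by (simp add: cinner_self)
  finally have "(cmod (cinner x y))\<^sup>2 \<le> (norm x * norm y)\<^sup>2"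
    using False by (simp add: field_simps power_mult_distrib)
  then show ?thesis by (rule power2_le_imp_le) simp
qed simp

lemma bounded_linear_cinner_left: "bounded_linear (\<lambda>x. cinner x y)"
proof (rule bounded_linear_intro)
  show "norm (cinner x y) \<le> norm x * norm y" for x
    by (rule cinner_cauchy_schwarz)
qed (simp_all add: cinner_add_left scaleR_scaleC cinner_scaleC_left scaleR_conv_of_real)

lemma bounded_linear_cinner_right: "bounded_linear (\<lambda>y. cinner x y)"
proof (rule bounded_linear_intro)
  show "norm (cinner x y) \<le> norm y * norm x" for y
    by (metis cinner_cauchy_schwarz mult.commute)
qed (simp_all add: cinner_add_right scaleR_scaleC cinner_scaleC_right scaleR_conv_of_real)

text \<open>Removing from \<open>z\<close> its component along \<open>y\<close> lowers the squared
  norm by \<open>|<z,y>|^2 / |y|^2\<close>, so minimality forces \<open><z,y> = 0\<close>.\<close>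

lemma minimizer_orthogonal:
  fixes z :: "'a::chilbert_space"
  assumes "csubspace S" and min: "\<And>y. y \<in> S \<Longrightarrow> norm z \<le> norm (z - y)"
  shows "z \<in> ortho_compl cinner S"
  unfolding ortho_compl_def
proof (intro CollectI ballI)
  fix y assume y: "y \<in> S"
  show "cinner z y = 0"
  proof (cases "y = 0")
    case False
    define t where "t = cinner y z / (norm y)\<^sup>2"
    have "(norm z)\<^sup>2 \<le> (norm (z - t *\<^sub>C y))\<^sup>2"
      using min assms(1) y by (intro power_mono) (auto intro: complex_vector.subspace_scale)
    also have "\<dots> = (norm z)\<^sup>2 - 2 * Re (t * cinner z y) + (cmod t)\<^sup>2 * (norm y)\<^sup>2"
      by (simp add: norm_diff_sqr cinner_scaleC_right norm_scaleC power_mult_distrib)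
    also have "Re (t * cinner z y) = (cmod (cinner z y))\<^sup>2 / (norm y)\<^sup>2"
      by (simp add: t_def cinner_commute[symmetric, of z y] complex_norm_square[symmetric] mult.commute
          flip: of_real_power of_real_divide)
    also have "(cmod t)\<^sup>2 * (norm y)\<^sup>2 = (cmod (cinner z y))\<^sup>2 / (norm y)\<^sup>2"
    proof -
      have "cmod t = cmod (cinner z y) / (norm y)\<^sup>2"
        by (simp add: t_def cinner_commute[symmetric, of z y] norm_divide norm_power)
      then show ?thesis using False by (simp add: field_simps power2_eq_square)
    qed
    finally show ?thesis using False by (simp add: field_simps)
  qed simp
qed

lemma hilbert_projection:
  fixes S :: "'a::chilbert_space set"
  assumes closed: "closed S" and sub: "csubspace S"
  shows "S + ortho_compl cinner S = UNIV"
proof -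
  have "x \<in> S + ortho_compl cinner S" for x
  proof -
    define D where "D = infdist x S"
    have ne: "S \<noteq> {}" using sub complex_vector.subspace_0 by blast
    have D: "D \<le> norm (x - y)" if "y \<in> S" for y
      unfolding D_def using infdist_le[OF that, of x] by (simp add: dist_norm)
    have D0: "D \<ge> 0" by (simp add: D_def infdist_nonneg)
    have "\<exists>y\<in>S. norm (x - y) < D + inverse (real (Suc n))" for n
    proof (rule ccontr)
      assume "\<not> ?thesis"
      then have "\<And>y. y \<in> S \<Longrightarrow> D + inverse (real (Suc n)) \<le> dist x y"
        by (auto simp: dist_norm not_less)
      then have "D + inverse (real (Suc n)) \<le> (INF y\<in>S. dist x y)"
        using ne by (intro cINF_greatest)
      then have "D + inverse (real (Suc n)) \<le> D"
        by (simp add: D_def infdist_def ne)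
      then show False by simp
    qed
    then obtain f where f: "\<And>n. f n \<in> S" "\<And>n. norm (x - f n) < D + inverse (real (Suc n))"
      by metis
    have lim: "(\<lambda>n. norm (x - f n)) \<longlonglongrightarrow> D"
    proof (rule tendsto_sandwich[where f = "\<lambda>_. D" and h = "\<lambda>n. D + inverse (real (Suc n))"])
      show "(\<lambda>n. D + inverse (real (Suc n))) \<longlonglongrightarrow> D"
        using tendsto_add[OF tendsto_const LIMSEQ_inverse_real_of_nat, of D] by simp
      show "\<forall>\<^sub>F n in sequentially. D \<le> norm (x - f n)" using D f by simp
      show "\<forall>\<^sub>F n in sequentially. norm (x - f n) \<le> D + inverse (real (Suc n))"
        using f(2) by (intro always_eventually allI less_imp_le)
    qed simp
    \<comment> \<open>Parallelogram law: the midpoint of \<open>f m\<close> and \<open>f n\<close>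
      lies in \<open>S\<close>, hence at distance at least \<open>D\<close> from \<open>x\<close>.
      This makes a minimizing sequence Cauchy.\<close>
    have par: "(norm (f m - f n))\<^sup>2 \<le> 2 * (norm (x - f m))\<^sup>2 + 2 * (norm (x - f n))\<^sup>2 - 4 * D\<^sup>2" for m n
    proof -
      have "(1/2) *\<^sub>C (f m + f n) \<in> S"
        using f sub by (intro complex_vector.subspace_scale complex_vector.subspace_add)
      then have "D \<le> norm (x - (1/2) *\<^sub>C (f m + f n))" by (rule D)
      also have "x - (1/2) *\<^sub>C (f m + f n) = (1/2) *\<^sub>C ((x - f m) + (x - f n))"
        by (simp add: scaleC_add_right scaleC_diff_right flip: scaleC_add_left)
      finally have "2 * D \<le> norm ((x - f m) + (x - f n))"
        by (simp add: norm_scaleC)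
      then have "4 * D\<^sup>2 \<le> (norm ((x - f m) + (x - f n)))\<^sup>2"
        using D0 power_mono[of "2 * D" _ 2] by (simp add: power_mult_distrib)
      moreover have "(norm (f m - f n))\<^sup>2 = (norm ((x - f m) - (x - f n)))\<^sup>2"
        by (simp add: norm_minus_commute)
      ultimately show ?thesis
        unfolding norm_add_sqr norm_diff_sqr[of "x - f m" "x - f n"] by linarith
    qed
    have "Cauchy f"
    proof (rule metric_CauchyI)
      fix e :: real assume e: "e > 0"
      have "(\<lambda>n. 2 * (norm (x - f n))\<^sup>2 - 2 * D\<^sup>2) \<longlonglongrightarrow> 2 * D\<^sup>2 - 2 * D\<^sup>2"
        by (intro tendsto_intros lim)
      then have "\<forall>\<^sub>F n in sequentially. 2 * (norm (x - f n))\<^sup>2 - 2 * D\<^sup>2 < e\<^sup>2 / 2"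
        using e by (intro order_tendstoD(2)[of _ 0]) auto
      then obtain k where k: "\<And>n. n \<ge> k \<Longrightarrow> 2 * (norm (x - f n))\<^sup>2 - 2 * D\<^sup>2 < e\<^sup>2 / 2"
        by (auto simp: eventually_sequentially)
      have "(norm (f m - f n))\<^sup>2 < e\<^sup>2" if "m \<ge> k" "n \<ge> k" for m n
        using par[of m n] k[OF that(1)] k[OF that(2)] by linarith
      then show "\<exists>k. \<forall>m\<ge>k. \<forall>n\<ge>k. dist (f m) (f n) < e"
        using e by (metis dist_norm power2_less_imp_less less_imp_le)
    qed
    then obtain u where u: "f \<longlonglongrightarrow> u" using Cauchy_convergent convergent_def by blast
    then have "u \<in> S" using closed f closed_sequentially by blast
    moreover have "(\<lambda>n. norm (x - f n)) \<longlonglongrightarrow> norm (x - u)"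
      by (intro tendsto_intros u)
    then have "norm (x - u) = D" using lim LIMSEQ_unique by blast
    then have "x - u \<in> ortho_compl cinner S"
      using D \<open>u \<in> S\<close> sub
      by (intro minimizer_orthogonal) (auto simp: diff_diff_eq intro!: D complex_vector.subspace_add)
    ultimately have "u + (x - u) \<in> S + ortho_compl cinner S" by (intro set_plus_intro)
    then show ?thesis by simp
  qed
  then show ?thesis by auto
qed

lemma closed_ortho_compl:
  fixes ip :: "'v::topological_space \<Rightarrow> 'v \<Rightarrow> 'c::{t2_space,zero}"
  assumes "\<And>y. continuous_on UNIV (\<lambda>x. ip x y)"
  shows "closed (ortho_compl ip S)"
proof -
  have "ortho_compl ip S = (\<Inter>y\<in>S. {x. ip x y = 0})"
    by (auto simp: ortho_compl_def)
  then show ?thesis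
    using assms by (auto intro!: closed_Collect_eq)
qed

lemma closed_ortho_compl_cinner: "closed (ortho_compl cinner S)"
  by (intro closed_ortho_compl bounded_linear.continuous_on[OF bounded_linear_cinner_left]
      continuous_on_id)

lemma ortho_compl_closure_cspan:
  assumes "\<And>s. s \<in> S \<Longrightarrow> cinner u s = 0"
  shows "u \<in> ortho_compl cinner (closure (cspan S))"
proof -
  let ?Z = "{v. cinner u v = 0}"
  have "csubspace ?Z"
    by (simp add: complex_vector.subspace_def cinner_add_right cinner_scaleC_right)
  then have "cspan S \<subseteq> ?Z"
    using assms by (intro complex_vector.span_minimal) auto
  moreover have "closed ?Z"
    by (intro closed_Collect_eq bounded_linear.continuous_on[OF bounded_linear_cinner_right]
        continuous_on_id continuous_on_const)
  ultimately have "closure (cspan S) \<subseteq> ?Z" by (rule closure_minimal)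
  then show ?thesis by (auto simp: ortho_compl_def)
qed

lemma ortho_proj_pythagoras:
  fixes S :: "'k::chilbert_space set"
  assumes "closed S" "csubspace S"
  shows "(norm x)\<^sup>2 = (norm (x - ortho_proj cinner S x))\<^sup>2 + (norm (ortho_proj cinner S x))\<^sup>2"
proof -
  note sub = assms(2) hilbert_projection[OF assms]
  let ?p = "ortho_proj cinner S x"
  have "cinner (x - ?p) ?p = 0"
    using cinner.ortho_proj_in[OF sub] cinner.ortho_proj_compl[OF sub]
    by (auto simp: ortho_compl_def)
  then show ?thesis using norm_add_sqr[of "x - ?p" ?p] by simp
qed

lemma
  fixes S :: "'k::chilbert_space set"
  assumes "closed S" "csubspace S"
  shows norm_ortho_proj_le: "norm (ortho_proj cinner S x) \<le> norm x"
    and norm_diff_ortho_proj_le: "norm (x - ortho_proj cinner S x) \<le> norm x"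
  by (rule power2_le_imp_le; simp add: ortho_proj_pythagoras[OF assms, of x])+

lemma bounded_linear_ortho_proj:
  fixes S :: "'k::chilbert_space set"
  assumes "closed S" "csubspace S"
  shows "bounded_linear (ortho_proj cinner S)"
proof (rule bounded_linear_intro)
  show "norm (ortho_proj cinner S x) \<le> norm x * 1" for x
    using norm_ortho_proj_le[OF assms] by simp
qed (simp_all add: scaleR_scaleC cinner.ortho_proj_add[OF assms(2) hilbert_projection[OF assms]]
    cinner.ortho_proj_scaleC[OF assms(2) hilbert_projection[OF assms]])

lemma (in definite_form) ortho_proj_subset:
  assumes V: "csubspace V" "V + ortho_compl ip V = UNIV"
    and W: "csubspace W" "W + ortho_compl ip W = UNIV" and "W \<subseteq> V"
  shows "ortho_proj ip W (ortho_proj ip V x) = ortho_proj ip W x"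
proof (rule ortho_proj_eqI[OF W])
  show "ortho_proj ip W x \<in> W" by (rule ortho_proj_in[OF W])
  have "x - ortho_proj ip V x \<in> ortho_compl ip W"
    using ortho_proj_compl[OF V] \<open>W \<subseteq> V\<close> by (auto simp: ortho_compl_def)
  then have "(x - ortho_proj ip W x) - (x - ortho_proj ip V x) \<in> ortho_compl ip W"
    by (rule complex_vector.subspace_diff[OF csubspace_ortho_compl ortho_proj_compl[OF W]])
  then show "ortho_proj ip V x - ortho_proj ip W x \<in> ortho_compl ip W" by simp
qed

text \<open>The norms \<open>a\<^sub>k = \<parallel>(G F)\<^sup>k \<xi>\<parallel>\<close> are logarithmically convex, so they
  grow at least geometrically with ratio \<open>a\<^sub>1 / a\<^sub>0\<close>. Any bound \<open>C s\<^sup>k\<close> forces this ratio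
  to be at most \<open>s\<close>, whatever the constant \<open>C\<close>.\<close>

lemma norm_le_of_power_growth:
  fixes F G :: "'k::chilbert_space \<Rightarrow> 'k"
  assumes adjoint: "\<And>x y. cinner (F x) y = cinner x (G y)"
    and growth: "\<And>k. norm (((G \<circ> F) ^^ k) \<xi>) \<le> C * s ^ k" and s: "s \<ge> 0"
  shows "(norm (F \<xi>))\<^sup>2 \<le> s * (norm \<xi>)\<^sup>2"
proof (cases "\<xi> = 0")
  case True
  have "cinner (F 0) y = 0" for y by (simp add: adjoint)
  then show ?thesis using True cinner.form_definite[of "F 0"] by simp
next
  case False
  define A where "A = G \<circ> F"
  define a where "a k = norm ((A ^^ k) \<xi>)" for k
  have a0: "a 0 > 0" using False by (simp add: a_def)
  have A_self_adjoint: "cinner (A x) y = cinner x (A y)" for x y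
    unfolding A_def comp_def by (metis adjoint cinner_commute)
  have convex: "(a (Suc k))\<^sup>2 \<le> a k * a (Suc (Suc k))" for k
  proof -
    \<comment> \<open>One factor of the self-adjoint \<open>A\<close> moves across the inner
      product; Cauchy-Schwarz then gives log-convexity.\<close>
    have "complex_of_real ((a (Suc k))\<^sup>2) = cinner ((A ^^ k) \<xi>) ((A ^^ Suc (Suc k)) \<xi>)"
      by (simp only: a_def funpow.simps comp_apply A_self_adjoint cinner_self[symmetric])
    then have "(a (Suc k))\<^sup>2 = cmod (cinner ((A ^^ k) \<xi>) ((A ^^ Suc (Suc k)) \<xi>))"
      by (metis abs_of_nonneg norm_of_real zero_le_power2)
    also have "\<dots> \<le> a k * a (Suc (Suc k))" unfolding a_def by (rule cinner_cauchy_schwarz)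
    finally show ?thesis .
  qed
  define \<rho> where "\<rho> = a 1 / a 0"
  have \<rho>: "\<rho> \<ge> 0" by (simp add: \<rho>_def a_def)
  have ratio: "\<rho> * a k \<le> a (Suc k)" for k
  proof (induction k)
    case 0
    then show ?case using a0 by (simp add: \<rho>_def)
  next
    case (Suc k)
    show ?case
    proof (cases "a (Suc k) = 0")
      case True
      then show ?thesis by (simp add: a_def)
    next
      case False
      then have pos: "a (Suc k) > 0" using norm_ge_zero unfolding a_def by (simp add: less_le)
      have "\<rho> * a (Suc k) * a (Suc k) \<le> \<rho> * (a k * a (Suc (Suc k)))"
        using mult_left_mono[OF convex \<rho>, of k] by (simp add: power2_eq_square mult.assoc)
      also have "\<dots> \<le> a (Suc k) * a (Suc (Suc k))"
        using mult_right_mono[OF Suc, of "a (Suc (Suc k))"] by (simp add: a_def mult.assoc)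
      finally show ?thesis using pos by (simp add: mult.commute[of "a (Suc k)"])
    qed
  qed
  have geometric: "\<rho> ^ k * a 0 \<le> a k" for k
  proof (induction k)
    case (Suc k)
    have "\<rho> ^ Suc k * a 0 = \<rho> * (\<rho> ^ k * a 0)" by simp
    also have "\<dots> \<le> \<rho> * a k" by (rule mult_left_mono[OF Suc \<rho>])
    finally show ?case using ratio[of k] by linarith
  qed simp
  have bound: "\<rho> ^ k * a 0 \<le> C * s ^ k" for k
    using geometric[of k] growth[of k] by (simp add: a_def A_def)
  have "\<rho> \<le> s"
  proof (rule ccontr)
    assume "\<not> \<rho> \<le> s"
    show False
    proof (cases "s = 0")
      case True
      then show False using bound[of 1] a0 \<open>\<not> \<rho> \<le> s\<close> by (simp add: mult_le_0_iff)
    next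
      case False
      then have "s > 0" using s by simp
      then have "1 < \<rho> / s" using \<open>\<not> \<rho> \<le> s\<close> by simp
      then obtain k where "C / a 0 < (\<rho> / s) ^ k" using real_arch_pow by blast
      then have "C * s ^ k < \<rho> ^ k * a 0"
        using a0 \<open>s > 0\<close> by (simp add: power_divide field_simps)
      then show False using bound[of k] by simp
    qed
  qed
  have "complex_of_real ((norm (F \<xi>))\<^sup>2) = cinner \<xi> (A \<xi>)"
    by (simp only: A_def comp_apply adjoint cinner_self[symmetric])
  then have "(norm (F \<xi>))\<^sup>2 = cmod (cinner \<xi> (A \<xi>))"
    by (metis abs_of_nonneg norm_of_real zero_le_power2)
  also have "\<dots> \<le> norm \<xi> * a 1"
    using cinner_cauchy_schwarz[of \<xi> "A \<xi>"] by (simp add: a_def)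
  also have "\<dots> = \<rho> * (norm \<xi>)\<^sup>2"
    using a0 by (simp add: \<rho>_def a_def power2_eq_square)
  also have "\<dots> \<le> s * (norm \<xi>)\<^sup>2" using \<open>\<rho> \<le> s\<close> by (intro mult_right_mono) auto
  finally show ?thesis .
qed

section \<open>Square roots in C*-algebras\<close>

lemma adj_zero [simp]: "adj 0 = (0::'b::cstar_algebra)"
  using adj_add[of "0::'b" 0] by simp

lemma adj_uminus: "adj (- x) = - adj (x::'b::cstar_algebra)"
  using adj_add[of x "- x"] by (simp add: eq_neg_iff_add_eq_0 add.commute)

lemma adj_diff: "adj (x - y) = adj x - adj (y::'b::cstar_algebra)"
  using adj_add[of x "- y"] by (simp add: adj_uminus)

lemma adj_scaleR: "adj (r *\<^sub>R x) = r *\<^sub>R adj (x::'b::cstar_algebra)"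
  by (simp add: scaleR_scaleC adj_scaleC)

lemma norm_adj: "norm (adj x) = norm (x::'b::cstar_algebra)"
proof -
  have le: "norm x \<le> norm (adj x)" for x :: 'b
  proof (cases "x = 0")
    case False
    have "norm x * norm x \<le> norm (adj x) * norm x"
      using norm_mult_ineq[of "adj x" x] by (simp add: cstar_identity power2_eq_square)
    then show ?thesis using False by simp
  qed simp
  show ?thesis using le[of x] le[of "adj x"] by (simp add: adj_adj)
qed

text \<open>Turns a bound on left multiplication into a norm bound. Without a unit to insert for
  \<open>x\<close>, \<open>adj d\<close> takes its place through the C*-identity.\<close>

lemma norm_le_of_mult_le:
  fixes d :: "'b::cstar_algebra"
  assumes "\<And>x. norm (d * x) \<le> \<alpha> * norm x" and 0: "\<alpha> \<ge> 0"
  shows "norm d \<le> \<alpha>"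
proof (cases "d = 0")
  case True
  then show ?thesis using 0 by simp
next
  case False
  have "(norm d)\<^sup>2 = norm (d * adj d)"
    using cstar_identity[of "adj d"] by (simp add: adj_adj norm_adj)
  also have "\<dots> \<le> \<alpha> * norm d" using assms(1)[of "adj d"] by (simp add: norm_adj)
  finally show ?thesis using False by (simp add: power2_eq_square)
qed

text \<open>A square root \<open>1 - Z\<close> of \<open>1 - W\<close> for a contraction \<open>W\<close> solves \<open>2 Z = W + Z\<^sup>2\<close>. Without a unit,
  \<open>W\<close> and \<open>Z\<close> are operators \<open>x \<mapsto> \<epsilon> x + w x\<close> and \<open>x \<mapsto> \<epsilon> x + z x\<close> with \<open>\<epsilon> \<in> {0, 1}\<close>. The iterates
  \<open>Z\<^sub>n\<^sub>+\<^sub>1 = (W + Z\<^sub>n\<^sup>2) / 2\<close>, \<open>Z\<^sub>0 = 0\<close>, and their increments are bounded by those of the scalar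
  iteration with \<open>W = 1\<close>, which increases to \<open>1\<close>; \<open>Z\<^sub>n\<close> has scalar part \<open>\<epsilon>\<close> times the \<open>n\<close>-th scalar
  iterate.\<close>

fun root_majorant :: "nat \<Rightarrow> real" where
  "root_majorant 0 = 0"
| "root_majorant (Suc n) = (1 + (root_majorant n)\<^sup>2) / 2"

lemma root_majorant_bounds: "0 \<le> root_majorant n" "root_majorant n \<le> 1"
proof -
  have "0 \<le> root_majorant n \<and> root_majorant n \<le> 1"
    by (induction n) (auto simp: power_le_one add_nonneg_nonneg)
  then show "0 \<le> root_majorant n" "root_majorant n \<le> 1" by auto
qed

lemma root_majorant_mono: "root_majorant n \<le> root_majorant (Suc n)"
  \<comment> \<open>The increment is half the square of \<open>root_majorant n - 1\<close>.\<close>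
  using zero_le_power2[of "root_majorant n - 1"] by (simp add: power2_diff)

lemma root_majorant_tendsto: "root_majorant \<longlonglongrightarrow> 1"
proof -
  have inc: "incseq root_majorant" by (rule incseq_SucI) (rule root_majorant_mono)
  obtain l where l: "root_majorant \<longlonglongrightarrow> l"
    using incseq_convergent[OF inc, of 1] root_majorant_bounds by blast
  have "(\<lambda>n. root_majorant (Suc n)) \<longlonglongrightarrow> (1 + l\<^sup>2) / 2"
    unfolding root_majorant.simps by (intro tendsto_intros l) auto
  then have "l = (1 + l\<^sup>2) / 2" using LIMSEQ_Suc[OF l] LIMSEQ_unique by blast
  then have "(l - 1)\<^sup>2 = 0" by (simp add: power2_diff)
  then show ?thesis using l by simp
qed

text \<open>The algebra part of \<open>Z\<^sub>n\<close>. The last summand collects the two cross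
  terms from squaring a scalar part plus an algebra part; the square of the scalar part stays with
  \<open>root_majorant\<close>, as \<epsilon> is idempotent.\<close>

fun root_iter :: "real \<Rightarrow> 'b::cstar_algebra \<Rightarrow> nat \<Rightarrow> 'b" where
  "root_iter \<epsilon> w 0 = 0"
| "root_iter \<epsilon> w (Suc n) = (1/2) *\<^sub>R (w + root_iter \<epsilon> w n * root_iter \<epsilon> w n
      + (2 * \<epsilon> * root_majorant n) *\<^sub>R root_iter \<epsilon> w n)"

text \<open>The limit inherits self-adjointness and contractivity from the iterates. It also
  commutes with whatever commutes with \<open>w\<close>, since the iterates are polynomials in
  \<open>w\<close>.\<close>

lemma contraction_root:
  fixes w :: "'b::cstar_algebra"
  assumes \<epsilon>: "\<epsilon> = 0 \<or> \<epsilon> = 1" and w: "adj w = w"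
    and contr: "\<And>x. norm (\<epsilon> *\<^sub>R x + w * x) \<le> norm x"
  obtains z where "adj z = z" "2 *\<^sub>R z = w + z * z + (2 * \<epsilon>) *\<^sub>R z"
    "\<And>x. norm (\<epsilon> *\<^sub>R x + z * x) \<le> norm x" "\<And>d. d * w = w * d \<Longrightarrow> d * z = z * d"
proof -
  let ?z = "root_iter \<epsilon> w" and ?m = root_majorant
  define Z where "Z n x = (\<epsilon> * ?m n) *\<^sub>R x + ?z n * x" for n x
  have Z_diff: "Z n (x - y) = Z n x - Z n y" for n x y
    by (simp add: Z_def algebra_simps)
  have Z_Suc: "Z (Suc n) x = (1/2) *\<^sub>R (\<epsilon> *\<^sub>R x + w * x + Z n (Z n x))" for n x
    using \<epsilon> by (auto simp: Z_def algebra_simps power2_eq_square scaleR_2 simp flip: scaleR_add_left)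
  have Z_bound: "norm (Z n x) \<le> ?m n * norm x" for n x
  proof (induction n arbitrary: x)
    case (Suc n)
    have "norm (Z n (Z n x)) \<le> (?m n)\<^sup>2 * norm x"
      using order.trans[OF Suc mult_left_mono[OF Suc root_majorant_bounds(1)]]
      by (simp add: power2_eq_square mult.assoc)
    then have "norm (\<epsilon> *\<^sub>R x + w * x + Z n (Z n x)) \<le> norm x + (?m n)\<^sup>2 * norm x"
      using contr[of x] norm_triangle_ineq[of "\<epsilon> *\<^sub>R x + w * x" "Z n (Z n x)"] by linarith
    then show ?case
      unfolding Z_Suc norm_scaleR root_majorant.simps by (simp add: distrib_right)
  qed (simp add: Z_def)
  have Z_step: "norm (Z (Suc n) x - Z n x) \<le> (?m (Suc n) - ?m n) * norm x" for n x
  proof (induction n arbitrary: x)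
    case 0
    then show ?case using Z_bound[of "Suc 0" x] by (simp add: Z_def)
  next
    case (Suc n)
    have half: "a - b = (1/2) *\<^sub>R (p - q)" if "a = (1/2) *\<^sub>R (v + p)" "b = (1/2) *\<^sub>R (v + q)"
      for a b p q v :: 'b
      using that by (simp add: algebra_simps)
    \<comment> \<open>A difference of squares split as \<open>A(A - B) + (A - B)B\<close>, which
      avoids commuting operators. The bounds for the two summands add up to the next scalar
      increment.\<close>
    have "Z (Suc (Suc n)) x - Z (Suc n) x
        = (1/2) *\<^sub>R (Z (Suc n) (Z (Suc n) x - Z n x) + (Z (Suc n) (Z n x) - Z n (Z n x)))"
      using half[OF Z_Suc Z_Suc, of "Suc n" x n] by (simp add: Z_diff)
    also have "norm \<dots> \<le> (1/2) * (norm (Z (Suc n) (Z (Suc n) x - Z n x))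
        + norm (Z (Suc n) (Z n x) - Z n (Z n x)))"
      by (simp add: norm_triangle_ineq)
    also have "\<dots> \<le> (1/2) * (?m (Suc n) * ((?m (Suc n) - ?m n) * norm x)
        + (?m (Suc n) - ?m n) * (?m n * norm x))"
    proof -
      have "norm (Z (Suc n) (Z (Suc n) x - Z n x)) \<le> ?m (Suc n) * ((?m (Suc n) - ?m n) * norm x)"
        using order.trans[OF Z_bound mult_left_mono[OF Suc root_majorant_bounds(1)]] .
      moreover have "norm (Z (Suc n) (Z n x) - Z n (Z n x)) \<le> (?m (Suc n) - ?m n) * (?m n * norm x)"
        using root_majorant_mono[of n]
        by (intro order.trans[OF Suc mult_left_mono[OF Z_bound]]) linarith
      ultimately show ?thesis by (intro mult_left_mono add_mono) auto
    qed
    also have "\<dots> = (?m (Suc (Suc n)) - ?m (Suc n)) * norm x"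
      by (simp only: root_majorant.simps(2)[of "Suc n"])
        (simp add: field_simps power2_eq_square)
    finally show ?case .
  qed
  \<comment> \<open>The factor 2 pays once for the increment of \<open>Z\<close> and once for
    removing its scalar part.\<close>
  have step: "norm (?z (Suc n) - ?z n) \<le> 2 * (?m (Suc n) - ?m n)" for n
  proof (rule norm_le_of_mult_le)
    fix x
    have "(?z (Suc n) - ?z n) * x
        = (Z (Suc n) x - Z n x) - (\<epsilon> * (?m (Suc n) - ?m n)) *\<^sub>R x"
      by (simp add: Z_def algebra_simps del: root_iter.simps root_majorant.simps)
    also have "norm \<dots> \<le> (?m (Suc n) - ?m n) * norm x + norm ((\<epsilon> * (?m (Suc n) - ?m n)) *\<^sub>R x)"
      by (rule order.trans[OF norm_triangle_ineq4 add_right_mono[OF Z_step]])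
    also have "\<dots> \<le> (?m (Suc n) - ?m n) * norm x + (?m (Suc n) - ?m n) * norm x"
      using \<epsilon> root_majorant_mono[of n] by (auto simp del: root_majorant.simps)
    also have "\<dots> = 2 * (?m (Suc n) - ?m n) * norm x"
      by (simp add: algebra_simps del: root_majorant.simps)
    finally show "norm ((?z (Suc n) - ?z n) * x) \<le> 2 * (?m (Suc n) - ?m n) * norm x" .
  qed (use root_majorant_mono[of n] in \<open>simp del: root_majorant.simps\<close>)
  have "summable (\<lambda>n. 2 * (?m (Suc n) - ?m n))"
    by (intro summable_mult telescope_summable[OF root_majorant_tendsto])
  then have "summable (\<lambda>n. ?z (Suc n) - ?z n)"
    by (rule summable_comparison_test'[where N = 0]) (rule step)
  then have "convergent (\<lambda>n. \<Sum>k<n. ?z (Suc k) - ?z k)"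
    by (simp add: summable_iff_convergent)
  then obtain z where z: "?z \<longlonglongrightarrow> z"
    by (auto simp: sum_lessThan_telescope convergent_def simp del: root_iter.simps(2))
  show thesis
  proof
    have adj_iter: "adj (?z n) = ?z n" for n
      by (induction n) (simp_all add: adj_add adj_scaleR adj_mult w)
    have "(\<lambda>n. adj (?z n)) \<longlonglongrightarrow> adj z"
      using z by (simp add: LIMSEQ_iff norm_adj flip: adj_diff)
    then show "adj z = z" using z by (simp add: adj_iter LIMSEQ_unique)
  next
    have "(\<lambda>n. ?z (Suc n)) \<longlonglongrightarrow> (1/2) *\<^sub>R (w + z * z + (2 * \<epsilon> * 1) *\<^sub>R z)"
      unfolding root_iter.simps by (intro tendsto_intros z root_majorant_tendsto)
    then have "z = (1/2) *\<^sub>R (w + z * z + (2 * \<epsilon> * 1) *\<^sub>R z)"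
      using LIMSEQ_Suc[OF z] LIMSEQ_unique by blast
    then have "2 *\<^sub>R z = 2 *\<^sub>R (1/2) *\<^sub>R (w + z * z + (2 * \<epsilon> * 1) *\<^sub>R z)" by (rule arg_cong)
    then show "2 *\<^sub>R z = w + z * z + (2 * \<epsilon>) *\<^sub>R z" by simp
  next
    fix x
    have "(\<lambda>n. Z n x) \<longlonglongrightarrow> (\<epsilon> * 1) *\<^sub>R x + z * x"
      unfolding Z_def by (intro tendsto_intros z root_majorant_tendsto)
    then have "(\<lambda>n. norm (Z n x)) \<longlonglongrightarrow> norm (\<epsilon> *\<^sub>R x + z * x)"
      using tendsto_norm by force
    moreover have "norm (Z n x) \<le> norm x" for n
      using order.trans[OF Z_bound mult_right_mono[OF root_majorant_bounds(2)]] by simp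
    ultimately show "norm (\<epsilon> *\<^sub>R x + z * x) \<le> norm x"
      by (intro LIMSEQ_le_const2) auto
  next
    fix d assume d: "d * w = w * d"
    have "d * ?z n = ?z n * d" for n
    proof (induction n)
      case (Suc n)
      then have "d * (?z n * ?z n) = ?z n * ?z n * d" by (metis mult.assoc)
      then show ?case using Suc d by (simp add: algebra_simps)
    qed simp
    moreover have "(\<lambda>n. d * ?z n) \<longlonglongrightarrow> d * z" "(\<lambda>n. ?z n * d) \<longlonglongrightarrow> z * d"
      by (intro tendsto_intros z)+
    ultimately show "d * z = z * d" by (simp add: LIMSEQ_unique)
  qed
qed

lemma one_minus_root:
  fixes w :: "'b::cstar_algebra"
  assumes w: "adj w = w" "norm w \<le> 1"
  obtains z where "adj z = z" "2 *\<^sub>R z = w + z * z" "\<And>d. d * w = w * d \<Longrightarrow> d * z = z * d"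
proof (rule contraction_root[of 0 w])
  show "norm (0 *\<^sub>R y + w * y) \<le> norm y" for y
    using norm_mult_ineq[of w y] mult_right_mono[OF w(2), of "norm y"] by simp
next
  fix z
  assume z: "adj z = z" "2 *\<^sub>R z = w + z * z + (2 * 0) *\<^sub>R z" "\<And>d. d * w = w * d \<Longrightarrow> d * z = z * d"
  show thesis
  proof (rule that)
    show "2 *\<^sub>R z = w + z * z" using z(2) by simp
  qed (fact z)+
qed (rule disjI1[OF refl], rule w)

text \<open>Formally \<open>x \<plusminus> \<i> (1 - z)\<close> are unitary when \<open>(1 - z)\<^sup>2 = 1 - x\<^sup>2\<close>, so \<open>1 - z\<close> is a contraction.\<close>

lemma contraction_one_minus_square:
  fixes x :: "'b::cstar_algebra"
  assumes x: "adj x = x" "norm x \<le> 1"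
  shows "norm (y - x * x * y) \<le> norm y"
proof -
  have adj_xx: "adj (x * x) = x * x" by (simp only: adj_mult x(1))
  have nx: "norm (x * x) \<le> 1"
    using x cstar_identity[of x] by (simp add: power_le_one)
  obtain z where z: "adj z = z" "2 *\<^sub>R z = x * x + z * z" "\<And>d. d * (x * x) = x * x * d \<Longrightarrow> d * z = z * d"
    using one_minus_root[OF adj_xx nx] by blast
  have xz: "x * z = z * x" by (rule z(3)) (rule mult.assoc[symmetric])
  \<comment> \<open>Isometry is stated through the action on \<open>y\<close>, as there need be no
    unit. The mixed terms cancel because \<open>x\<close> and \<open>z\<close> commute.\<close>
  have iso: "norm (x * y + c *\<^sub>C (y - z * y)) = norm y" if c: "c = \<i> \<or> c = - \<i>" for y c
  proof -
    have 1: "adj y * (x * (x * y)) + adj y * (z * (z * y)) = adj y * (z * y) + adj y * (z * y)"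
    proof -
      have "adj y * ((x * x + z * z) * y) = adj y * ((2 *\<^sub>R z) * y)" by (simp only: z(2))
      then show ?thesis by (simp add: algebra_simps scaleR_2)
    qed
    have 2: "x * (z * y) = z * (x * y)" by (metis xz mult.assoc)
    have 3: "c * c = - 1" using c by auto
    have 4: "cnj c = - c" using c by auto
    have "adj (x * y + c *\<^sub>C (y - z * y)) * (x * y + c *\<^sub>C (y - z * y))
      = adj y * (x * (x * y)) + c *\<^sub>C (adj y * (x * y)) - c *\<^sub>C (adj y * (x * (z * y)))
       + cnj c *\<^sub>C (adj y * (x * y)) - cnj c *\<^sub>C (adj y * (z * (x * y)))
       + (c * cnj c) *\<^sub>C (adj y * y - adj y * (z * y) - adj y * (z * y) + adj y * (z * (z * y)))"
      by (simp add: x(1) z(1) adj_add adj_diff adj_mult adj_scaleC algebra_simps scaleC_mult_left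
        scaleC_mult_right scaleC_scaleC scaleC_add_right complex_vector.scale_right_diff_distrib)
    also have "\<dots> = adj y * y"
      using 1 by (simp add: 2 3 4 algebra_simps scaleC_one)
    finally show ?thesis
      using cstar_identity[of y] cstar_identity[of "x * y + c *\<^sub>C (y - z * y)"]
      by (metis norm_ge_zero power2_eq_imp_eq)
  qed
  have contr: "norm (y - z * y) \<le> norm y" for y
  proof -
    let ?U = "\<lambda>c. x * y + c *\<^sub>C (y - z * y)"
    \<comment> \<open>Subtracting the two isometries isolates \<open>1 - z\<close>, and the triangle
      inequality bounds it by 1.\<close>
    have "?U \<i> - ?U (- \<i>) = (2 * \<i>) *\<^sub>C (y - z * y)"
      by (simp add: algebra_simps flip: scaleC_add_left)
    then have "2 * norm (y - z * y) = norm (?U \<i> - ?U (- \<i>))"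
      by (simp add: norm_scaleC norm_mult)
    also have "\<dots> \<le> norm y + norm y"
      using norm_triangle_ineq4[of "?U \<i>" "?U (- \<i>)"] iso[of \<i> y] iso[of "- \<i>" y]
      by (simp only: simp_thms)
    finally show ?thesis by simp
  qed
  \<comment> \<open>Formally \<open>1 - x^2 = (1 - z)^2\<close>, a product of two
    contractions.\<close>
  have "y - x * x * y = (y - z * y) - z * (y - z * y)"
  proof -
    have "(x * x + z * z) * y = (2 *\<^sub>R z) * y" by (simp only: z(2))
    then have "x * (x * y) + z * (z * y) = z * y + z * y" by (simp add: algebra_simps scaleR_2)
    then show ?thesis by (simp add: algebra_simps)
  qed
  then show ?thesis using order.trans[OF contr[of "y - z * y"] contr[of y]] by (simp only:)
qed

text \<open>\<open>t * t\<close> plays the role of the absolute value of \<open>x\<close>, and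
  \<open>t\<close> is its square root. Keeping \<open>t\<close> makes positivity of the absolute
  value visible in every representation.\<close>

lemma abs_value_square:
  fixes x :: "'b::cstar_algebra"
  assumes x: "adj x = x" "norm x \<le> 1"
  obtains t where "adj t = t" "t * t * (t * t) = x * x" "\<And>d. d * x = x * d \<Longrightarrow> d * t = t * d"
proof -
  \<comment> \<open>A square root of \<open>y\<close> when \<open>1 - y\<close> is a contraction:
    take \<epsilon> = 1 and \<open>w = - y\<close>, so that \<open>W = 1 - y\<close> and
    \<open>1 - Z = - z\<close>. Since \<open>1 - s\<close> is again a contraction, the step can be
    applied twice, to \<open>x * x\<close> and then to the resulting root.\<close>
  have root: thesis
    if y: "adj y = y" and c: "\<And>x. norm (x - y * x) \<le> norm x"
      and s: "\<And>s. \<lbrakk>adj s = s; s * s = y; \<And>x. norm (x - s * x) \<le> norm x;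
        \<And>d. d * y = y * d \<Longrightarrow> d * s = s * d\<rbrakk> \<Longrightarrow> thesis" for y :: 'b and thesis
  proof (rule contraction_root[of 1 "- y"])
    fix z assume z: "adj z = z" "2 *\<^sub>R z = - y + z * z + (2 * 1) *\<^sub>R z"
      "\<And>x. norm (1 *\<^sub>R x + z * x) \<le> norm x" "\<And>d. d * - y = - y * d \<Longrightarrow> d * z = z * d"
    show thesis
    proof (rule s[of "- z"])
      show "- z * - z = y" using z(2) by simp
      show "d * - z = - z * d" if "d * y = y * d" for d using z(4)[of d] that by simp
      show "norm (x - - z * x) \<le> norm x" for x using z(3)[of x] by simp
    qed (simp add: z(1) adj_uminus)
  qed (simp_all add: y c adj_uminus)
  show thesis
  proof (rule root[of "x * x"])
    fix s assume s: "adj s = s" "s * s = x * x" "\<And>x. norm (x - s * x) \<le> norm x"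
      "\<And>d. d * (x * x) = x * x * d \<Longrightarrow> d * s = s * d"
    show thesis
    proof (rule root[of s])
      fix t assume t: "adj t = t" "t * t = s" "\<And>d. d * s = s * d \<Longrightarrow> d * t = t * d"
      show thesis
      proof (rule that[of t])
        fix d assume "d * x = x * d"
        then have "d * (x * x) = x * x * d" by (metis mult.assoc)
        then show "d * t = t * d" by (intro t s)
      qed (simp_all only: t(1,2) s(2))
    qed (simp_all only: s(1,3))
  qed (use x in \<open>simp_all add: adj_mult contraction_one_minus_square\<close>)
qed

text \<open>\<open>a\<close> is the real part of the normal element \<open>g = a + \<i> b\<close>, and \<open>g\<^sup>*g = a\<^sup>2 + b\<^sup>2\<close>.\<close>

lemma norm_le_norm_add_squares:
  fixes a b :: "'b::cstar_algebra"
  assumes "adj a = a" "adj b = b" "a * b = b * a"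
  shows "(norm a)\<^sup>2 \<le> norm (a * a + b * b)"
proof -
  have adj_g: "adj (a + \<i> *\<^sub>C b) = a - \<i> *\<^sub>C b"
    using assms by (simp add: adj_add adj_scaleC)
  have "adj (a + \<i> *\<^sub>C b) * (a + \<i> *\<^sub>C b) = a * a + b * b"
    unfolding adj_g using assms
    by (simp add: algebra_simps scaleC_mult_left scaleC_mult_right scaleC_scaleC scaleC_one)
  then have g: "(norm (a + \<i> *\<^sub>C b))\<^sup>2 = norm (a * a + b * b)"
    by (metis cstar_identity)
  have "2 *\<^sub>R a = (a + \<i> *\<^sub>C b) + adj (a + \<i> *\<^sub>C b)"
    unfolding adj_g by (simp add: scaleR_2)
  then have "norm (2 *\<^sub>R a) \<le> norm (a + \<i> *\<^sub>C b) + norm (adj (a + \<i> *\<^sub>C b))"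
    by (metis norm_triangle_ineq)
  then have "norm a \<le> norm (a + \<i> *\<^sub>C b)" by (simp add: norm_adj)
  then show ?thesis unfolding g[symmetric] by (simp add: power_mono)
qed

section \<open>Representations\<close>

context cstar_representation
begin

lemma rep_linear: "linear (\<pi> b)"
  using rep_bounded by (rule bounded_linear.linear)

lemma rep_zero [simp]: "\<pi> b 0 = 0" "\<pi> 0 h = 0"
  using linear_0[OF rep_linear] rep_scaleC[of 0 0 h] by simp_all

lemma rep_diff: "\<pi> (a - b) h = \<pi> a h - \<pi> b h"
  using rep_add[of "a - b" b h] by simp

lemma rep_scaleR: "\<pi> (r *\<^sub>R b) h = complex_of_real r *\<^sub>C \<pi> b h"
  by (simp add: scaleR_scaleC rep_scaleC)

lemma cinner_rep: "cinner (\<pi> b h) k = cinner h (\<pi> (adj b) k)"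
  using rep_adj[of "adj b"] by (simp add: adj_adj)

lemma norm_rep_sqr: "complex_of_real ((norm (\<pi> c h))\<^sup>2) = cinner h (\<pi> (adj c * c) h)"
  by (simp add: rep_mult cinner_rep[symmetric] cinner_self)

text \<open>If \<open>2z - z\<^sup>2 = a\<^sup>*a\<close> with \<open>z\<close> self-adjoint, then formally
  \<open>1 - a\<^sup>*a = (1 - z)\<^sup>2\<close>, so that \<open>\<parallel>h\<parallel>\<^sup>2 - \<parallel>\<pi>(a) h\<parallel>\<^sup>2 = \<parallel>h - \<pi>(z) h\<parallel>\<^sup>2\<close>.\<close>

lemma norm_rep_le: "norm (\<pi> a h) \<le> norm a * norm h"
proof -
  have unit: "norm (\<pi> a h) \<le> norm h" if "norm a \<le> 1" for a
  proof -
    have "norm (adj a * a) \<le> 1" using that by (simp add: cstar_identity power_le_one)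
    moreover have "adj (adj a * a) = adj a * a" by (simp only: adj_mult adj_adj)
    ultimately obtain z where z: "adj z = z" "2 *\<^sub>R z = adj a * a + z * z"
      using one_minus_root by blast
    have "(norm (h - \<pi> z h))\<^sup>2 = (norm h)\<^sup>2 - Re (cinner h (\<pi> (2 *\<^sub>R z - z * z) h))"
    proof -
      have "complex_of_real ((norm (\<pi> z h))\<^sup>2) = cinner h (\<pi> (z * z) h)"
        using norm_rep_sqr[of z h] z(1) by simp
      then have "(norm (\<pi> z h))\<^sup>2 = Re (cinner h (\<pi> (z * z) h))"
        by (metis Re_complex_of_real)
      then show ?thesis
        by (simp add: norm_diff_sqr rep_diff rep_scaleR cinner.form_diff_right cinner_scaleC_right)
    qed
    also have "2 *\<^sub>R z - z * z = adj a * a" using z(2) by simp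
    also have "Re (cinner h (\<pi> (adj a * a) h)) = (norm (\<pi> a h))\<^sup>2"
      using norm_rep_sqr[of a h] by (metis Re_complex_of_real)
    finally have "(norm (\<pi> a h))\<^sup>2 \<le> (norm h)\<^sup>2"
      using zero_le_power2[of "norm (h - \<pi> z h)"] by linarith
    then show ?thesis by (rule power2_le_imp_le) simp
  qed
  show ?thesis
  proof (cases "a = 0")
    case False
    have "norm (\<pi> ((1 / norm a) *\<^sub>R a) h) \<le> norm h" using False by (intro unit) simp
    then show ?thesis using False by (simp add: rep_scaleR norm_scaleC norm_divide field_simps)
  qed simp
qed

text \<open>With \<open>|x| = t * t\<close>, the element \<open>d = x + |x|\<close> is twice the
  positive part and \<open>|x| d = x d\<close>. On the range of \<pi>\<open>(d)\<close> the
  nonnegative form of \<open>|x|\<close> thus agrees with the nonpositive form of \<open>x\<close>,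
  so both vanish there. Hence \<pi>\<open>(d)\<close> squares to zero, and self-adjointness makes it
  zero.\<close>

lemma rep_positive_part_zero:
  assumes x: "adj x = x" and t: "adj t = t" "t * t * (t * t) = x * x" "x * t = t * x"
    and neg: "\<And>h. Re (cinner h (\<pi> x h)) \<le> 0"
  shows "\<pi> (x + t * t) h = 0"
proof -
  define d where "d = x + t * t"
  define k where "k = \<pi> d h"
  have d: "adj d = d" by (simp add: d_def adj_add adj_mult x t)
  have comm: "x * (t * t) = t * t * x" by (metis t(3) mult.assoc)
  have "t * t * d = x * d"
    unfolding d_def by (simp only: distrib_left comm t(2) add.commute)
  then have eq: "\<pi> (t * t) k = \<pi> x k"
    unfolding k_def by (metis rep_mult)
  have "(norm (\<pi> t k))\<^sup>2 = Re (cinner k (\<pi> x k))"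
    using norm_rep_sqr[of t k] by (metis Re_complex_of_real t(1) eq)
  then have "\<pi> t k = 0" using neg[of k] by (metis power2_less_eq_zero_iff norm_eq_zero)
  then have "\<pi> x k = 0" by (simp flip: eq add: rep_mult)
  then have "\<pi> d k = 0" using eq by (simp add: d_def rep_add)
  then have "cinner k k = 0"
    unfolding k_def by (simp add: cinner_rep d)
  then show ?thesis by (metis cinner.form_definite k_def d_def)
qed

end

text \<open>Injectivity gives the lower norm bound without spectral theory: if \<open>\<pi>(b) \<le> r\<close> for
  \<open>b = c\<^sup>*c\<close>, then \<open>\<pi>\<close> annihilates the positive part of \<open>b\<^sup>2 - r b\<close>, so \<open>b\<^sup>2 - r b = - s\<^sup>2\<close>
  for some self-adjoint \<open>s\<close> commuting with \<open>b\<close>, and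
  \<open>\<parallel>b\<parallel>\<^sup>2 \<le> \<parallel>b\<^sup>2 + s\<^sup>2\<parallel> = r \<parallel>b\<parallel>\<close>.\<close>

lemma (in faithful_representation) norm_sqr_le_of_rep:
  assumes r: "r \<ge> 0" and c: "\<And>h. (norm (\<pi> c h))\<^sup>2 \<le> r * (norm h)\<^sup>2"
  shows "(norm c)\<^sup>2 \<le> r"
proof -
  define b where "b = adj c * c"
  have b: "adj b = b" by (simp add: b_def adj_mult adj_adj)
  \<comment> \<open>An operator and its adjoint have the same bound; combined with
    \<open>b = adj c * c\<close> this yields \<pi>\<open>(b)^2\<close> \<le> \<open>r\<close>
    \<pi>\<open>(b)\<close>.\<close>
  have adj_bound: "(norm (\<pi> (adj c) k))\<^sup>2 \<le> r * (norm k)\<^sup>2" for k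
  proof -
    let ?u = "\<pi> (adj c) k"
    have "(norm ?u)\<^sup>2 = cmod (cinner k (\<pi> c ?u))"
      using arg_cong[OF norm_rep_sqr[of "adj c" k], of cmod]
      by (simp add: adj_adj rep_mult norm_power)
    also have "\<dots> \<le> norm k * norm (\<pi> c ?u)" by (rule cinner_cauchy_schwarz)
    finally have "((norm ?u)\<^sup>2)\<^sup>2 \<le> (norm k * norm (\<pi> c ?u))\<^sup>2" by (intro power_mono) auto
    also have "\<dots> \<le> (norm k)\<^sup>2 * (r * (norm ?u)\<^sup>2)"
      unfolding power_mult_distrib by (intro mult_left_mono c) auto
    finally have le: "(norm ?u)\<^sup>2 * (norm ?u)\<^sup>2 \<le> r * (norm k)\<^sup>2 * (norm ?u)\<^sup>2"
      by (simp add: power2_eq_square mult_ac)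
    show ?thesis
    proof (cases "?u = 0")
      case False
      then show ?thesis using mult_right_le_imp_le[OF le] by simp
    qed (use r in simp)
  qed
  define x0 where "x0 = b * b - r *\<^sub>R b"
  \<comment> \<open>Scales \<open>x0\<close> into the unit ball, as \<open>abs_value_square\<close>
    requires; \<open>+ 1\<close> covers \<open>x0 = 0\<close>. The later factor in \<open>s\<close>
    undoes this scaling.\<close>
  define \<kappa> where "\<kappa> = inverse (norm x0 + 1)"
  define x where "x = \<kappa> *\<^sub>R x0"
  have \<kappa>: "\<kappa> > 0" by (simp add: \<kappa>_def add_nonneg_pos)
  have x: "adj x = x" by (simp add: x_def x0_def adj_scaleR adj_diff adj_mult b)
  have "norm x \<le> 1" using \<kappa> by (simp add: x_def \<kappa>_def field_simps)
  then obtain t where t: "adj t = t" "t * t * (t * t) = x * x"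
    and comm: "\<And>d. d * x = x * d \<Longrightarrow> d * t = t * d"
    using abs_value_square[OF x] by metis
  have xt: "x * t = t * x" by (rule comm) (rule refl)
  have bt: "b * t = t * b"
    by (rule comm) (simp add: x_def x0_def algebra_simps)
  have "Re (cinner h (\<pi> x h)) \<le> 0" for h
  proof -
    have "complex_of_real ((norm (\<pi> b h))\<^sup>2) = cinner h (\<pi> (b * b) h)"
      using norm_rep_sqr[of b h] by (simp add: b)
    then have "(norm (\<pi> b h))\<^sup>2 = Re (cinner h (\<pi> (b * b) h))" by (metis Re_complex_of_real)
    moreover have "(norm (\<pi> c h))\<^sup>2 = Re (cinner h (\<pi> b h))"
      using norm_rep_sqr[of c h] unfolding b_def by (metis Re_complex_of_real)
    moreover have "(norm (\<pi> b h))\<^sup>2 \<le> r * (norm (\<pi> c h))\<^sup>2"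
      using adj_bound[of "\<pi> c h"] by (simp add: b_def rep_mult)
    ultimately have "Re (cinner h (\<pi> x0 h)) \<le> 0"
      by (simp add: x0_def rep_diff rep_scaleR cinner.form_diff_right cinner_scaleC_right)
    then show ?thesis
      using \<kappa> by (simp add: x_def rep_scaleR cinner_scaleC_right mult_le_0_iff)
  qed
  then have "\<pi> (x + t * t) h = 0" for h by (intro rep_positive_part_zero x t xt)
  then have "\<pi> (x + t * t) = \<pi> 0" by (simp add: fun_eq_iff)
  then have "x + t * t = 0" by (rule injD[OF rep_inj])
  define s where "s = (1 / sqrt \<kappa>) *\<^sub>R t"
  have "\<kappa> *\<^sub>R (s * s) = t * t" using \<kappa> by (simp add: s_def)
  then have "\<kappa> *\<^sub>R (b * b - r *\<^sub>R b + s * s) = x + t * t"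
    by (simp only: scaleR_add_right x_def x0_def)
  with \<open>x + t * t = 0\<close> \<kappa> have "b * b - r *\<^sub>R b + s * s = 0"
    by (simp del: scaleR_add_right scaleR_right_diff_distrib)
  then have "b * b + s * s = r *\<^sub>R b" by (simp add: algebra_simps)
  moreover have "adj s = s" "b * s = s * b" by (simp_all add: s_def adj_scaleR t bt)
  ultimately have "(norm b)\<^sup>2 \<le> r * norm b"
    using norm_le_norm_add_squares[of b s] b r by simp
  then have "norm b \<le> r"
    using r by (cases "b = 0") (simp_all add: power2_eq_square)
  then show ?thesis by (simp add: b_def cstar_identity)
qed

section \<open>Hilbert modules and their localizations\<close>

context hilbert_cstar_module
begin

lemma ip_add_left: "ip (x + y) z = ip x z + ip y z"
  by (metis ip_add_right ip_adj adj_add)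

lemma ip_scaleC_left: "ip (c *\<^sub>C x) y = cnj c *\<^sub>C ip x y"
  by (metis ip_scaleC_right ip_adj adj_scaleC)

sublocale form: definite_form ip
proof
  fix x y
  show "ip x y = 0 \<Longrightarrow> ip y x = 0" by (metis ip_adj adj_zero)
  show "ip x x = 0 \<Longrightarrow> x = 0" using norm_ip[of x] by simp
qed (simp_all add: ip_add_left ip_add_right ip_scaleC_left)

lemma norm_sqr_ip: "(norm x)\<^sup>2 = norm (ip x x)"
  by (simp add: norm_ip)

end

lemma complemented_submoduleD:
  assumes "complemented_submodule act ip S"
  shows "csubspace S" "S + ortho_compl ip S = UNIV"
  using assms by (simp_all add: complemented_submodule_def closed_submodule_def whole_direct_sum_def)

section \<open>Elementary tensors and localized projections\<close>

context interior_tensor_product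
begin

lemma localized_subspace: "closed (localized tens S)" "csubspace (localized tens S)"
  unfolding localized_def by (simp_all add: csubspace_closure complex_vector.subspace_span)

lemma tens_in_localized: "x \<in> S \<Longrightarrow> tens x h \<in> localized tens S"
  unfolding localized_def
  by (rule closure_subset[THEN subsetD], rule complex_vector.span_base) auto

lemma tens_in_ortho_compl_localized:
  assumes "x \<in> ortho_compl ip S"
  shows "tens x h \<in> ortho_compl cinner (localized tens S)"
  unfolding localized_def
proof (rule ortho_compl_closure_cspan)
  fix v assume "v \<in> {tens y k |y k. y \<in> S}"
  then show "cinner (tens x h) v = 0"
    using assms by (auto simp: tens_inner ortho_compl_def)
qed

lemmas localized_projection = hilbert_projection[OF localized_subspace]

text \<open>The splitting of \<open>x\<close> along \<open>S\<close> and its complement survives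
  tensoring with \<open>h\<close>: \<open>tens_inner\<close> keeps the two pieces
  orthogonal.\<close>

lemma ortho_proj_localized_tens:
  assumes "complemented_submodule act ip S"
  shows "ortho_proj cinner (localized tens S) (tens x h) = tens (ortho_proj ip S x) h"
proof (rule cinner.ortho_proj_eqI[OF localized_subspace(2) localized_projection])
  note S = complemented_submoduleD[OF assms]
  show "tens (ortho_proj ip S x) h \<in> localized tens S"
    by (intro tens_in_localized form.ortho_proj_in[OF S])
  have "tens (x - ortho_proj ip S x) h \<in> ortho_compl cinner (localized tens S)"
    by (intro tens_in_ortho_compl_localized form.ortho_proj_compl[OF S])
  moreover have "tens (x - y) h = tens x h - tens y h" for y
    using tens_add_left[of "x - y" y h] by simp
  ultimately show "tens x h - tens (ortho_proj ip S x) h \<in> ortho_compl cinner (localized tens S)"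
    by simp
qed

text \<open>Writing \<open>ip x x\<close> as \<open>adj c * c\<close> reduces the comparison of
  \<open>x\<close> with its elementary tensors to that of \<open>c\<close> with
  \<pi>\<open>(c)\<close>.\<close>

lemma norm_tens:
  obtains c where "adj c * c = ip x x" "norm x = norm c" "\<And>h. norm (tens x h) = norm (\<pi> c h)"
proof -
  obtain c where c: "ip x x = adj c * c"
    using ip_self_positive unfolding cstar_positive_def by blast
  show thesis
  proof
    show "adj c * c = ip x x" by (simp add: c)
    show "norm x = norm c" by (simp add: norm_ip c cstar_identity)
    fix h
    have "complex_of_real ((norm (tens x h))\<^sup>2) = cinner h (\<pi> (adj c * c) h)"
      by (simp only: cinner_self[symmetric] tens_inner c)
    also have "\<dots> = complex_of_real ((norm (\<pi> c h))\<^sup>2)" by (rule norm_rep_sqr[symmetric])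
    finally show "norm (tens x h) = norm (\<pi> c h)"
      by (simp only: of_real_eq_iff power2_eq_iff_nonneg norm_ge_zero)
  qed
qed

lemma norm_tens_le: "norm (tens x h) \<le> norm x * norm h"
  using norm_tens[of x] norm_rep_le by metis

lemma tens_diff_left: "tens (x - y) h = tens x h - tens y h"
  using tens_add_left[of "x - y" y h] by simp

lemma bounded_linear_tens: "bounded_linear (\<lambda>x. tens x h)"
  by (rule bounded_linear_intro[OF _ _ norm_tens_le])
    (simp_all add: tens_add_left scaleR_scaleC tens_scaleC_left)

end

section \<open>Norm estimates transferred through a faithful representation\<close>

locale faithful_tensor_product =
  interior_tensor_product act ip \<pi> tens + faithful_representation \<pi>
  for act :: "'x::{complex_normed_vector,banach} \<Rightarrow> 'b::cstar_algebra \<Rightarrow> 'x"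
    and ip :: "'x \<Rightarrow> 'x \<Rightarrow> 'b"
    and \<pi> :: "'b \<Rightarrow> 'h::chilbert_space \<Rightarrow> 'h"
    and tens :: "'x \<Rightarrow> 'h \<Rightarrow> 'k::chilbert_space"
begin

lemma norm_le_of_tens:
  assumes \<alpha>: "\<alpha> \<ge> 0" and tens: "\<And>h. norm (tens x h) \<le> \<alpha> * norm h"
  shows "norm x \<le> \<alpha>"
proof -
  obtain c where c: "norm x = norm c" "\<And>h. norm (tens x h) = norm (\<pi> c h)"
    using norm_tens by metis
  have "(norm c)\<^sup>2 \<le> \<alpha>\<^sup>2"
  proof (rule norm_sqr_le_of_rep)
    show "(norm (\<pi> c h))\<^sup>2 \<le> \<alpha>\<^sup>2 * (norm h)\<^sup>2" for h
      unfolding power_mult_distrib[symmetric]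
      using tens[of h] by (intro power_mono) (simp_all add: c)
  qed simp
  then show ?thesis unfolding c(1) using \<alpha> by (rule power2_le_imp_le)
qed

text \<open>Cauchy-Schwarz for the module, pulled back from the localization: for \<open>u\<close> =
  \<pi>\<open>(ip x y) k\<close>, the squared norm of \<open>u\<close> is the inner product of
  \<open>tens x u\<close> and \<open>tens y k\<close>.\<close>

lemma norm_ip_le: "norm (ip x y) \<le> norm x * norm y"
proof -
  have "norm (\<pi> (ip x y) k) \<le> norm x * norm y * norm k" for k
  proof -
    let ?u = "\<pi> (ip x y) k"
    have "complex_of_real ((norm ?u)\<^sup>2) = cinner (tens x ?u) (tens y k)"
      by (simp only: tens_inner cinner_self)
    then have "(norm ?u)\<^sup>2 = cmod (cinner (tens x ?u) (tens y k))"
      by (metis abs_of_nonneg norm_of_real zero_le_power2)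
    also have "\<dots> \<le> norm (tens x ?u) * norm (tens y k)" by (rule cinner_cauchy_schwarz)
    also have "\<dots> \<le> (norm x * norm ?u) * (norm y * norm k)"
      by (intro mult_mono norm_tens_le) auto
    finally have le: "norm ?u * norm ?u \<le> norm x * norm y * norm k * norm ?u"
      by (simp add: power2_eq_square mult_ac)
    show ?thesis
    proof (cases "?u = 0")
      case False
      then show ?thesis using mult_right_le_imp_le[OF le] by simp
    qed simp
  qed
  then have "(norm (\<pi> (ip x y) k))\<^sup>2 \<le> (norm x * norm y)\<^sup>2 * (norm k)\<^sup>2" for k
    unfolding power_mult_distrib[symmetric] by (intro power_mono) simp_all
  then have "(norm (ip x y))\<^sup>2 \<le> (norm x * norm y)\<^sup>2"
    by (intro norm_sqr_le_of_rep) auto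
  then show ?thesis by (rule power2_le_imp_le) simp
qed

lemma closed_ortho_compl_ip: "closed (ortho_compl ip S)"
proof (rule closed_ortho_compl)
  fix y
  have "bounded_linear (\<lambda>x. ip x y)"
    by (rule bounded_linear_intro[OF _ _ norm_ip_le])
      (simp_all add: ip_add_left scaleR_scaleC ip_scaleC_left)
  then show "continuous_on UNIV (\<lambda>x. ip x y)"
    by (rule bounded_linear.continuous_on) (rule continuous_on_id)
qed

lemma norm_adjoint_le:
  assumes adj: "\<And>x y. ip (T x) y = ip x (T' y)" and T: "\<And>x. norm (T x) \<le> t * norm x"
  shows "norm (T' y) \<le> t * norm y"
proof (cases "T' y = 0")
  case True
  have "0 \<le> t * norm y" using order.trans[OF norm_ge_zero T] .
  then show ?thesis by (simp add: True)
next
  case False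
  have "(norm (T' y))\<^sup>2 = norm (ip (T (T' y)) y)"
    by (simp add: norm_sqr_ip adj)
  also have "\<dots> \<le> norm (T (T' y)) * norm y" by (rule norm_ip_le)
  also have "\<dots> \<le> t * norm (T' y) * norm y" by (intro mult_right_mono T) simp
  finally have "norm (T' y) * norm (T' y) \<le> t * norm y * norm (T' y)"
    by (simp add: power2_eq_square mult_ac)
  then show ?thesis using False by (simp add: mult_right_le_imp_le)
qed

text \<open>For a finite sum of elementary tensors the triangle inequality gives a constant that
  depends on the sum. Iterating \<open>G \<circ> F\<close> makes that constant harmless by
  \<open>norm_le_of_power_growth\<close>.\<close>

lemma norm_amplification_le:
  fixes F G :: "'k \<Rightarrow> 'k"
  assumes F: "bounded_linear F" "\<And>x h. F (tens x h) = tens (T x) h"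
    and G: "bounded_linear G" "\<And>x h. G (tens x h) = tens (T' x) h"
    and FC: "\<And>c \<xi>. F (c *\<^sub>C \<xi>) = c *\<^sub>C F \<xi>" and GC: "\<And>c \<xi>. G (c *\<^sub>C \<xi>) = c *\<^sub>C G \<xi>"
    and adjoint: "\<And>\<xi> \<eta>. cinner (F \<xi>) \<eta> = cinner \<xi> (G \<eta>)"
    and ip_adjoint: "\<And>x y. ip (T x) y = ip x (T' y)"
    and T: "\<And>x. norm (T x) \<le> t * norm x" and t: "t \<ge> 0"
  shows "norm (F \<xi>) \<le> t * norm \<xi>"
proof -
  let ?A = "G \<circ> F"
  define S where "S x = T' (T x)" for x
  have A_tens: "(?A ^^ k) (tens x h) = tens ((S ^^ k) x) h" for k x h
    by (induction k) (simp_all add: F G S_def)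
  have S_bound: "norm ((S ^^ k) x) \<le> (t\<^sup>2) ^ k * norm x" for k x
  proof (induction k)
    case (Suc k)
    let ?y = "(S ^^ k) x"
    have "norm (T' (T ?y)) \<le> t * norm (T ?y)" by (rule norm_adjoint_le[OF ip_adjoint T])
    also have "\<dots> \<le> t * (t * norm ?y)" by (intro mult_left_mono T t)
    also have "\<dots> \<le> t * (t * ((t\<^sup>2) ^ k * norm x))" by (intro mult_left_mono Suc t)
    finally show ?case by (simp add: S_def[of ?y] power2_eq_square mult_ac)
  qed simp
  have A_add: "(?A ^^ k) (\<xi> + \<eta>) = (?A ^^ k) \<xi> + (?A ^^ k) \<eta>" for k \<xi> \<eta>
    by (induction k) (simp_all add: linear_add[OF bounded_linear.linear] F(1) G(1))
  have A_scale: "(?A ^^ k) (c *\<^sub>C \<xi>) = c *\<^sub>C (?A ^^ k) \<xi>" for k c \<xi>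
    by (induction k) (simp_all add: FC GC)
  \<comment> \<open>\<open>C\<close> may depend on the vector; this is what makes the set a
    subspace.\<close>
  let ?P = "{\<xi>. \<exists>C. \<forall>k. norm ((?A ^^ k) \<xi>) \<le> C * (t\<^sup>2) ^ k}"
  have "csubspace ?P"
    unfolding complex_vector.subspace_def
  proof (intro conjI ballI allI)
    have "(?A ^^ k) 0 = 0" for k using A_scale[of k 0 0] by simp
    then show "0 \<in> ?P" by (auto intro!: exI[of _ 0])
  next
    fix \<xi> \<eta> assume "\<xi> \<in> ?P" "\<eta> \<in> ?P"
    then obtain C D where "\<And>k. norm ((?A ^^ k) \<xi>) \<le> C * (t\<^sup>2) ^ k" "\<And>k. norm ((?A ^^ k) \<eta>) \<le> D * (t\<^sup>2) ^ k"
      by blast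
    then have "norm ((?A ^^ k) (\<xi> + \<eta>)) \<le> (C + D) * (t\<^sup>2) ^ k" for k
      unfolding A_add distrib_right by (intro order.trans[OF norm_triangle_ineq add_mono])
    then show "\<xi> + \<eta> \<in> ?P" by blast
  next
    fix c \<xi> assume "\<xi> \<in> ?P"
    then obtain C where "\<And>k. norm ((?A ^^ k) \<xi>) \<le> C * (t\<^sup>2) ^ k" by blast
    then have "norm ((?A ^^ k) (c *\<^sub>C \<xi>)) \<le> (cmod c * C) * (t\<^sup>2) ^ k" for k
      unfolding A_scale norm_scaleC mult.assoc by (intro mult_left_mono) auto
    then show "c *\<^sub>C \<xi> \<in> ?P" by blast
  qed
  moreover have "tens x h \<in> ?P" for x h
  proof -
    have "norm ((?A ^^ k) (tens x h)) \<le> (norm x * norm h) * (t\<^sup>2) ^ k" for k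
      unfolding A_tens
      using order.trans[OF norm_tens_le mult_right_mono[OF S_bound norm_ge_zero]]
      by (simp add: mult_ac)
    then show ?thesis by blast
  qed
  ultimately have span: "cspan {tens x h |x h. True} \<subseteq> ?P"
    by (intro complex_vector.span_minimal) auto
  have "norm (F \<xi>) \<le> t * norm \<xi>" if "\<xi> \<in> cspan {tens x h |x h. True}" for \<xi>
  proof -
    have "\<xi> \<in> ?P" using that span by (rule subsetD[rotated])
    then obtain C where "\<And>k. norm ((?A ^^ k) \<xi>) \<le> C * (t\<^sup>2) ^ k" by blast
    from norm_le_of_power_growth[OF adjoint this] have "(norm (F \<xi>))\<^sup>2 \<le> (t * norm \<xi>)\<^sup>2"
      by (simp add: power_mult_distrib)
    then show ?thesis by (rule power2_le_imp_le) (simp add: t)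
  qed
  then have "cspan {tens x h |x h. True} \<subseteq> {\<xi>. norm (F \<xi>) \<le> t * norm \<xi>}" by blast
  moreover have "closed {\<xi>. norm (F \<xi>) \<le> t * norm \<xi>}"
    by (intro closed_Collect_le continuous_intros bounded_linear.continuous_on[OF F(1)])
  ultimately have "closure (cspan {tens x h |x h. True}) \<subseteq> {\<xi>. norm (F \<xi>) \<le> t * norm \<xi>}"
    by (rule closure_minimal)
  then show ?thesis using tens_dense by blast
qed

lemma norm_ortho_proj_ip_le:
  assumes "complemented_submodule act ip S"
  shows "norm (ortho_proj ip S x) \<le> norm x"
proof (rule norm_le_of_tens)
  fix h
  have "norm (tens (ortho_proj ip S x) h) \<le> norm (tens x h)"
    unfolding ortho_proj_localized_tens[OF assms, symmetric]
    by (rule norm_ortho_proj_le[OF localized_subspace])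
  also have "\<dots> \<le> norm x * norm h" by (rule norm_tens_le)
  finally show "norm (tens (ortho_proj ip S x) h) \<le> norm x * norm h" .
qed simp

text \<open>Makes the sum in the definition of concordance orthogonal, so that it yields the
  projection onto the intersection.\<close>

lemma closure_ortho_compl_sum_subset:
  "closure (ortho_compl ip M + ortho_compl ip N) \<subseteq> ortho_compl ip (M \<inter> N)"
proof (rule closure_minimal[OF _ closed_ortho_compl_ip])
  show "ortho_compl ip M + ortho_compl ip N \<subseteq> ortho_compl ip (M \<inter> N)"
    by (auto simp: set_plus_def ortho_compl_def form.form_add_left)
qed

end

section \<open>The local Friedrichs angle\<close>

locale complemented_pair = faithful_tensor_product +
  fixes M N
  assumes M: "complemented_submodule act ip M" and N: "complemented_submodule act ip N"
begin

abbreviation "P \<equiv> ortho_proj cinner (localized tens M)"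
abbreviation "Q \<equiv> ortho_proj cinner (localized tens N)"
abbreviation "R \<equiv> ortho_proj cinner (localized tens M \<inter> localized tens N)"
abbreviation "p \<equiv> ortho_proj ip M"
abbreviation "q \<equiv> ortho_proj ip N"
abbreviation "F \<equiv> \<lambda>\<xi>. P (Q \<xi>) - R \<xi>"

lemma local_friedrichs_cos_eq: "local_friedrichs_cos tens M N = onorm F"
  by (simp add: local_friedrichs_cos_def friedrichs_cos_def)

lemma inter_subspace:
  "closed (localized tens M \<inter> localized tens N)" "csubspace (localized tens M \<inter> localized tens N)"
  using localized_subspace[of M] localized_subspace[of N]
  by (auto intro: complex_vector.subspace_inter)

lemmas M_sub = complemented_submoduleD[OF M]
lemmas N_sub = complemented_submoduleD[OF N]
lemmas PM_sub = localized_subspace(2)[of M] localized_projection[of M]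
lemmas QN_sub = localized_subspace(2)[of N] localized_projection[of N]
lemmas R_sub = inter_subspace(2) hilbert_projection[OF inter_subspace]

lemma bounded_linear_F: "bounded_linear F"
  by (intro bounded_linear_sub bounded_linear_compose[of P Q] bounded_linear_ortho_proj
      localized_subspace inter_subspace)

lemma PR: "P (R \<xi>) = R \<xi>" and QR: "Q (R \<xi>) = R \<xi>"
  using cinner.ortho_proj_in[OF R_sub, of \<xi>]
  by (simp_all add: cinner.ortho_proj_idem[OF PM_sub] cinner.ortho_proj_idem[OF QN_sub])

lemma RP: "R (P \<xi>) = R \<xi>" and RQ: "R (Q \<xi>) = R \<xi>"
  by (simp_all add: cinner.ortho_proj_subset[OF PM_sub R_sub] cinner.ortho_proj_subset[OF QN_sub R_sub])

lemma norm_F_le: "norm (F \<xi>) \<le> norm \<xi>"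
proof -
  \<comment> \<open>\<open>PQ\<close> fixes the range of \<open>R\<close>, so
    \<open>F = PQ(1 - R)\<close> is a product of contractions.\<close>
  have "F \<xi> = P (Q (\<xi> - R \<xi>))"
    by (simp add: cinner.ortho_proj_diff[OF PM_sub] cinner.ortho_proj_diff[OF QN_sub] PR QR)
  then have "norm (F \<xi>) \<le> norm (\<xi> - R \<xi>)"
    using order.trans[OF norm_ortho_proj_le[OF localized_subspace]
        norm_ortho_proj_le[OF localized_subspace]] by simp
  then show ?thesis using norm_diff_ortho_proj_le[OF inter_subspace] order.trans by blast
qed

lemma local_friedrichs_cos_le_1: "local_friedrichs_cos tens M N \<le> 1"
  unfolding local_friedrichs_cos_eq by (rule onorm_bound) (simp_all add: norm_F_le)

text \<open>The intersection of the localizations might exceed the localization of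
  \<open>M \<inter> N\<close>. Concordance excludes this: the complementary part of \<open>x\<close>
  is a limit of sums from the two orthogonal complements, whose tensors are orthogonal to both
  localizations' intersection.\<close>

lemma local_friedrichs_cos_concordant:
  assumes "concordant ip M N"
  shows "local_friedrichs_cos tens M N = friedrichs_cos ip M N"
proof -
  let ?r = "ortho_proj ip (M \<inter> N)"
  let ?T = "\<lambda>x. p (q x) - ?r x" and ?T' = "\<lambda>x. q (p x) - ?r x" and ?G = "\<lambda>\<xi>. Q (P \<xi>) - R \<xi>"
  let ?K = "closure (ortho_compl ip M + ortho_compl ip N)"
  have r_sub: "csubspace (M \<inter> N)" "M \<inter> N + ortho_compl ip (M \<inter> N) = UNIV"
  proof -
    show "csubspace (M \<inter> N)" using M_sub N_sub by (simp add: complex_vector.subspace_inter)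
    have "UNIV = M \<inter> N + ?K" using assms by (simp add: concordant_def whole_direct_sum_def)
    also have "\<dots> \<subseteq> M \<inter> N + ortho_compl ip (M \<inter> N)"
      by (intro set_plus_mono2 closure_ortho_compl_sum_subset subset_refl)
    finally show "M \<inter> N + ortho_compl ip (M \<inter> N) = UNIV" by blast
  qed
  have r_K: "x - ?r x \<in> ?K" for x
  proof -
    have "x \<in> M \<inter> N + ?K" using assms by (simp add: concordant_def whole_direct_sum_def)
    then obtain u v where uv: "u \<in> M \<inter> N" "v \<in> ?K" "x = u + v" by (rule set_plus_elim)
    then have "?r x = u"
      using closure_ortho_compl_sum_subset by (intro form.ortho_proj_eqI[OF r_sub]) auto
    then show ?thesis using uv by simp
  qed
  \<comment> \<open>Once \<open>R\<close> acts on elementary tensors through \<open>?r\<close>,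
    \<open>F\<close> is the amplification of \<open>?T\<close>; the norm comparison then runs in
    both directions.\<close>
  have R_tens: "R (tens x h) = tens (?r x) h" for x h
  proof (rule cinner.ortho_proj_eqI[OF R_sub])
    let ?W = "localized tens M \<inter> localized tens N"
    show "tens (?r x) h \<in> ?W"
      using form.ortho_proj_in[OF r_sub] by (auto intro: tens_in_localized)
    have "ortho_compl ip M + ortho_compl ip N \<subseteq> (\<lambda>v. tens v h) -` ortho_compl cinner ?W"
    proof (clarsimp elim!: set_plus_elim simp: tens_add_left)
      fix a b assume "a \<in> ortho_compl ip M" "b \<in> ortho_compl ip N"
      then have "tens a h \<in> ortho_compl cinner ?W" "tens b h \<in> ortho_compl cinner ?W"
        using tens_in_ortho_compl_localized by (fastforce simp: ortho_compl_def)+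
      then show "tens a h + tens b h \<in> ortho_compl cinner ?W"
        by (rule complex_vector.subspace_add[OF cinner.csubspace_ortho_compl])
    qed
    moreover have "closed ((\<lambda>v. tens v h) -` ortho_compl cinner ?W)"
      by (intro continuous_closed_vimage closed_ortho_compl_cinner
          linear_continuous_at bounded_linear_tens)
    ultimately have "?K \<subseteq> (\<lambda>v. tens v h) -` ortho_compl cinner ?W" by (rule closure_minimal)
    then show "tens x h - tens (?r x) h \<in> ortho_compl cinner ?W"
      using r_K[of x] by (auto simp: tens_diff_left)
  qed
  have F_tens: "F (tens x h) = tens (?T x) h" and G_tens: "?G (tens x h) = tens (?T' x) h" for x h
    by (simp_all add: ortho_proj_localized_tens M N R_tens tens_diff_left)
  have T_le: "norm (?T x) \<le> onorm F * norm x" for x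
  proof (rule norm_le_of_tens)
    show "0 \<le> onorm F * norm x" by (simp add: onorm_pos_le[OF bounded_linear_F])
    fix h
    have "norm (tens (?T x) h) \<le> onorm F * norm (tens x h)"
      unfolding F_tens[symmetric] by (rule onorm[OF bounded_linear_F])
    also have "\<dots> \<le> onorm F * (norm x * norm h)"
      by (intro mult_left_mono norm_tens_le onorm_pos_le[OF bounded_linear_F])
    finally show "norm (tens (?T x) h) \<le> onorm F * norm x * norm h" by (simp add: mult.assoc)
  qed
  have bounded_linear_T: "bounded_linear ?T"
  proof (rule bounded_linear_intro)
    show "norm (?T x) \<le> norm x * onorm F" for x using T_le[of x] by (simp add: mult.commute)
    show "?T (x + y) = ?T x + ?T y" for x y
      by (simp add: form.ortho_proj_add[OF M_sub] form.ortho_proj_add[OF N_sub] form.ortho_proj_add[OF r_sub])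
    show "?T (s *\<^sub>R x) = s *\<^sub>R ?T x" for s x
      by (simp add: scaleR_scaleC scaleC_diff_right form.ortho_proj_scaleC[OF M_sub]
          form.ortho_proj_scaleC[OF N_sub] form.ortho_proj_scaleC[OF r_sub])
  qed
  have "onorm F = onorm ?T"
  proof (rule antisym)
    show "onorm ?T \<le> onorm F" by (rule onorm_bound[OF onorm_pos_le[OF bounded_linear_F] T_le])
    show "onorm F \<le> onorm ?T"
    proof (rule onorm_bound[OF onorm_pos_le[OF bounded_linear_T]], rule norm_amplification_le[where G = ?G and T = ?T and T' = ?T'])
      show "bounded_linear F" by (rule bounded_linear_F)
      show "bounded_linear ?G"
        by (intro bounded_linear_sub bounded_linear_compose[of Q P] bounded_linear_ortho_proj
            localized_subspace inter_subspace)
      show "F (c *\<^sub>C \<xi>) = c *\<^sub>C F \<xi>" "?G (c *\<^sub>C \<xi>) = c *\<^sub>C ?G \<xi>" for c \<xi>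
        by (simp_all add: scaleC_diff_right cinner.ortho_proj_scaleC[OF PM_sub]
            cinner.ortho_proj_scaleC[OF QN_sub] cinner.ortho_proj_scaleC[OF R_sub])
      show "cinner (F \<xi>) \<eta> = cinner \<xi> (?G \<eta>)" for \<xi> \<eta>
        by (simp add: cinner.form_diff_left cinner.form_diff_right
            cinner.ortho_proj_self_adjoint[OF PM_sub] cinner.ortho_proj_self_adjoint[OF QN_sub]
            cinner.ortho_proj_self_adjoint[OF R_sub])
      show "ip (?T x) y = ip x (?T' y)" for x y
        by (simp add: form.form_diff_left form.form_diff_right
            form.ortho_proj_self_adjoint[OF M_sub] form.ortho_proj_self_adjoint[OF N_sub]
            form.ortho_proj_self_adjoint[OF r_sub])
      show "norm (?T x) \<le> onorm ?T * norm x" for x by (rule onorm[OF bounded_linear_T])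
      show "0 \<le> onorm ?T" by (rule onorm_pos_le[OF bounded_linear_T])
    qed (rule F_tens G_tens)+
  qed
  then show ?thesis unfolding local_friedrichs_cos_eq by (simp add: friedrichs_cos_def)
qed

text \<open>A gap \<open>c < 1\<close> makes the powers of \<open>Q P Q\<close> converge to \<open>R\<close> at rate \<open>c\<^sup>n\<close>. Since the norm of
  the module is recovered from elementary tensors, the powers of \<open>q p q\<close> converge as well, and
  their limit is the projection onto \<open>M \<inter> N\<close>.\<close>

lemma concordant_of_local_friedrichs_cos_less:
  assumes "local_friedrichs_cos tens M N < 1"
  shows "concordant ip M N"
proof -
  define c where "c = onorm F"
  have c: "0 \<le> c" "c < 1"
    using assms onorm_pos_le[OF bounded_linear_F] by (simp_all add: c_def local_friedrichs_cos_eq)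
  define A where "A \<xi> = Q (P (Q \<xi>))" for \<xi>
  define T where "T x = q (p (q x))" for x
  have A_diff: "A (\<xi> - \<eta>) = A \<xi> - A \<eta>" for \<xi> \<eta>
    by (simp add: A_def cinner.ortho_proj_diff[OF PM_sub] cinner.ortho_proj_diff[OF QN_sub])
  have A_pow_R: "(A ^^ n) (\<xi> - R \<xi>) = (A ^^ n) \<xi> - R \<xi>" for n \<xi>
    by (induction n) (simp_all add: A_diff, simp add: A_def PR QR)
  \<comment> \<open>On the kernel of \<open>R\<close>, \<open>A\<close> equals \<open>Q F\<close>
    and maps the kernel to itself, so each further power gains a factor \<open>c\<close>.\<close>
  have A_contr: "norm (A \<eta>) \<le> c * norm \<eta>" "R (A \<eta>) = 0" if "R \<eta> = 0" for \<eta>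
  proof -
    have "A \<eta> = Q (F \<eta>)" using that by (simp add: A_def)
    then have "norm (A \<eta>) \<le> norm (F \<eta>)" using norm_ortho_proj_le[OF localized_subspace] by simp
    then show "norm (A \<eta>) \<le> c * norm \<eta>"
      using onorm[OF bounded_linear_F, of \<eta>] by (simp add: c_def)
    show "R (A \<eta>) = 0" by (simp add: A_def RP RQ that)
  qed
  have A_pow: "norm ((A ^^ n) \<eta>) \<le> c ^ n * norm \<eta> \<and> R ((A ^^ n) \<eta>) = 0" if "R \<eta> = 0" for n \<eta>
  proof (induction n)
    case (Suc n)
    then have "norm ((A ^^ Suc n) \<eta>) \<le> c * norm ((A ^^ n) \<eta>)" using A_contr(1) by simp
    also have "\<dots> \<le> c * (c ^ n * norm \<eta>)" using Suc c by (intro mult_left_mono) auto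
    finally show ?case using Suc A_contr(2) by (simp add: mult.assoc)
  qed (simp add: that)
  have A_conv: "norm ((A ^^ n) \<xi> - R \<xi>) \<le> c ^ n * norm \<xi>" for n \<xi>
  proof -
    have "R (\<xi> - R \<xi>) = 0"
      by (simp add: cinner.ortho_proj_diff[OF R_sub]
          cinner.ortho_proj_idem[OF R_sub cinner.ortho_proj_in[OF R_sub]])
    then have "norm ((A ^^ n) \<xi> - R \<xi>) \<le> c ^ n * norm (\<xi> - R \<xi>)"
      using A_pow A_pow_R by metis
    also have "\<dots> \<le> c ^ n * norm \<xi>"
      using c norm_diff_ortho_proj_le[OF inter_subspace] by (intro mult_left_mono) auto
    finally show ?thesis .
  qed
  have A_tens: "(A ^^ n) (tens x h) = tens ((T ^^ n) x) h" for n x h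
    by (induction n) (simp_all add: A_def T_def ortho_proj_localized_tens M N)
  \<comment> \<open>No limit is available on \<open>X\<close> yet, so two powers are compared and
    \<open>R\<close> cancels in the localization.\<close>
  have T_diff: "norm ((T ^^ m) x - (T ^^ n) x) \<le> (c ^ m + c ^ n) * norm x" for m n x
  proof (rule norm_le_of_tens)
    show "0 \<le> (c ^ m + c ^ n) * norm x" using c by simp
    fix h
    let ?\<xi> = "tens x h"
    have "norm (tens ((T ^^ m) x - (T ^^ n) x) h) = norm (((A ^^ m) ?\<xi> - R ?\<xi>) - ((A ^^ n) ?\<xi> - R ?\<xi>))"
      by (simp add: tens_diff_left A_tens)
    also have "\<dots> \<le> c ^ m * norm ?\<xi> + c ^ n * norm ?\<xi>"
      by (intro order.trans[OF norm_triangle_ineq4] add_mono A_conv)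
    also have "\<dots> = (c ^ m + c ^ n) * norm ?\<xi>" by (simp add: distrib_right)
    also have "\<dots> \<le> (c ^ m + c ^ n) * (norm x * norm h)"
      using c by (intro mult_left_mono norm_tens_le) simp
    finally show "norm (tens ((T ^^ m) x - (T ^^ n) x) h) \<le> (c ^ m + c ^ n) * norm x * norm h"
      by (simp add: mult.assoc)
  qed
  have T_minus: "T (x - y) = T x - T y" for x y
    by (simp add: T_def form.ortho_proj_diff[OF M_sub] form.ortho_proj_diff[OF N_sub])
  have T_contr: "norm (T x) \<le> norm x" for x
    unfolding T_def using norm_ortho_proj_ip_le[OF M] norm_ortho_proj_ip_le[OF N] order.trans by meson
  let ?K = "ortho_compl ip M + ortho_compl ip N"
  have K_add: "x + y \<in> ?K" if "x \<in> ?K" "y \<in> ?K" for x y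
  proof -
    have "?K = {x + y |x y. x \<in> ortho_compl ip M \<and> y \<in> ortho_compl ip N}"
      by (auto simp: set_plus_def)
    then have "csubspace ?K"
      using complex_vector.subspace_sums[OF form.csubspace_ortho_compl form.csubspace_ortho_compl] by simp
    then show ?thesis using that by (rule complex_vector.subspace_add)
  qed
  have T_K: "x - T x \<in> ?K" for x
  proof -
    \<comment> \<open>Telescoping through \<open>q x\<close>, \<open>p (q x)\<close> and
      \<open>q (p (q x))\<close>: each difference lies in one of the two orthogonal
      complements.\<close>
    have "(q x - p (q x)) + ((x - q x) + (p (q x) - q (p (q x)))) \<in> ?K"
      by (intro set_plus_intro form.ortho_proj_compl[OF M_sub]
          complex_vector.subspace_add[OF form.csubspace_ortho_compl] form.ortho_proj_compl[OF N_sub])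
    then show ?thesis by (simp add: T_def)
  qed
  have pow_K: "x - (T ^^ n) x \<in> ?K" for n x
  proof (induction n)
    case 0
    have "0 + 0 \<in> ?K"
      by (intro set_plus_intro complex_vector.subspace_0 form.csubspace_ortho_compl)
    then show ?case by simp
  next
    case (Suc n)
    have "(x - (T ^^ n) x) + ((T ^^ n) x - T ((T ^^ n) x)) \<in> ?K" by (rule K_add[OF Suc T_K])
    then show ?case by simp
  qed
  have "x \<in> M \<inter> N + closure ?K" for x
  proof -
    have "Cauchy (\<lambda>n. (T ^^ n) x)"
    proof (rule metric_CauchyI)
      fix e :: real assume e: "e > 0"
      have "(\<lambda>n. c ^ n * norm x) \<longlonglongrightarrow> 0 * norm x"
        using c by (intro tendsto_intros LIMSEQ_power_zero) simp
      then have "\<forall>\<^sub>F n in sequentially. c ^ n * norm x < e / 2"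
        using e by (intro order_tendstoD(2)[of _ 0]) auto
      then obtain k where k: "\<And>n. n \<ge> k \<Longrightarrow> c ^ n * norm x < e / 2"
        by (auto simp: eventually_sequentially)
      have "dist ((T ^^ m) x) ((T ^^ n) x) < e" if "m \<ge> k" "n \<ge> k" for m n
        using T_diff[of m x n] k[OF that(1)] k[OF that(2)] by (simp add: dist_norm distrib_right)
      then show "\<exists>k. \<forall>m\<ge>k. \<forall>n\<ge>k. dist ((T ^^ m) x) ((T ^^ n) x) < e" by blast
    qed
    then obtain e where e: "(\<lambda>n. (T ^^ n) x) \<longlonglongrightarrow> e"
      using Cauchy_convergent convergent_def by blast
    have "(\<lambda>n. T ((T ^^ n) x)) \<longlonglongrightarrow> T e"
    proof (rule metric_tendsto_imp_tendsto[OF e])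
      show "\<forall>\<^sub>F n in sequentially. dist (T ((T ^^ n) x)) (T e) \<le> dist ((T ^^ n) x) e"
        by (simp add: dist_norm T_contr flip: T_minus)
    qed
    moreover have "(\<lambda>n. T ((T ^^ n) x)) \<longlonglongrightarrow> e" using LIMSEQ_Suc[OF e] by simp
    ultimately have Te: "T e = e" by (rule LIMSEQ_unique)
    \<comment> \<open>A fixed vector of \<open>q p q\<close> lies in both submodules: it is in the
      range of \<open>q\<close>, and \<open>ip e (p e) = ip e e\<close> forces
      \<open>e - p e\<close> to vanish.\<close>
    then have "e \<in> N" using form.ortho_proj_in[OF N_sub] unfolding T_def by metis
    then have qe: "q e = e" by (rule form.ortho_proj_idem[OF N_sub])
    have "ip e (p e) = ip (q e) (p e)" by (simp add: qe)
    also have "\<dots> = ip e (q (p (q e)))"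
      using form.ortho_proj_self_adjoint[OF N_sub, of e "p e"] by (simp add: qe)
    also have "\<dots> = ip e e" using Te by (simp add: T_def)
    finally have "ip e (e - p e) = 0" by (simp add: form.form_diff_right)
    moreover have "ip (p e) (e - p e) = 0"
      using form.ortho_proj_in[OF M_sub] form.ortho_proj_compl[OF M_sub]
      by (auto simp: ortho_compl_def intro: form.form_zero_commute)
    ultimately have "ip (e - p e) (e - p e) = 0" by (simp only: form.form_diff_left diff_self)
    then have "e - p e = 0" by (rule form.form_definite)
    then have "e \<in> M" using form.ortho_proj_in[OF M_sub, of e] by simp
    have "(\<lambda>n. x - (T ^^ n) x) \<longlonglongrightarrow> x - e" by (intro tendsto_intros e)
    then have "x - e \<in> closure ?K"
      unfolding closure_sequential by (intro exI[of _ "\<lambda>n. x - (T ^^ n) x"]) (simp add: pow_K)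
    then have "e + (x - e) \<in> M \<inter> N + closure ?K"
      using \<open>e \<in> M\<close> \<open>e \<in> N\<close> by (intro set_plus_intro) auto
    then show ?thesis by simp
  qed
  then have sum: "M \<inter> N + closure ?K = UNIV" by auto
  have "x = 0" if "x \<in> M \<inter> N" "x \<in> closure ?K" for x
  proof -
    have "ip x x = 0"
      using that closure_ortho_compl_sum_subset[of M N] by (auto simp: ortho_compl_def)
    then show ?thesis by (rule form.form_definite)
  qed
  moreover have "0 \<in> M \<inter> N" using M_sub N_sub by (simp add: complex_vector.subspace_0)
  moreover have "0 \<in> closure ?K" using pow_K[of 0 0] closure_subset by auto
  ultimately have "M \<inter> N \<inter> closure ?K = {0}" by blast
  with sum show ?thesis by (simp add: concordant_def whole_direct_sum_def)
qed

lemma local_friedrichs_cos_discordant: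
  "discordant ip M N \<Longrightarrow> local_friedrichs_cos tens M N = 1"
  using concordant_of_local_friedrichs_cos_less local_friedrichs_cos_le_1 by force

end

theorem proposition3p2:
  fixes act :: "'x::{complex_normed_vector,banach} \<Rightarrow> 'b::cstar_algebra \<Rightarrow> 'x"
    and ip :: "'x \<Rightarrow> 'x \<Rightarrow> 'b"
    and M N :: "'x set"
    and \<pi> :: "'b \<Rightarrow> 'h::chilbert_space \<Rightarrow> 'h"
    and tens :: "'x \<Rightarrow> 'h \<Rightarrow> 'k::chilbert_space"
    and \<pi>' :: "'b \<Rightarrow> 'h2::chilbert_space \<Rightarrow> 'h2"
    and tens' :: "'x \<Rightarrow> 'h2 \<Rightarrow> 'k2::chilbert_space"
  assumes "hilbert_cstar_module act ip"
    and "complemented_submodule act ip M"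
    and "complemented_submodule act ip N"
    and "faithful_representation \<pi>"
    and "interior_tensor_product act ip \<pi> tens"
  shows "(concordant ip M N \<longrightarrow> local_friedrichs_cos tens M N = friedrichs_cos ip M N)
    \<and> (discordant ip M N \<longrightarrow> local_friedrichs_cos tens M N = 1)
    \<and> (faithful_representation \<pi>' \<and> interior_tensor_product act ip \<pi>' tens'
        \<longrightarrow> local_friedrichs_cos tens M N = local_friedrichs_cos tens' M N)"
proof -
  \<comment> \<open>The right-hand side mentions neither the representation nor the tensor map. With
    the types of both left general, the fact applies to either representation and yields
    independence.\<close>
  have *: "local_friedrichs_cos \<tau> M N = (if concordant ip M N then friedrichs_cos ip M N else 1)"
    if "faithful_representation \<rho>" "interior_tensor_product act ip \<rho> \<tau>"
    for \<rho> :: "'b \<Rightarrow> 'l::chilbert_space \<Rightarrow> 'l" and \<tau> :: "'x \<Rightarrow> 'l \<Rightarrow> 'm::chilbert_space"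
  proof -
    interpret complemented_pair act ip \<rho> \<tau> M N
      using assms(2,3) that
      by (intro complemented_pair.intro faithful_tensor_product.intro complemented_pair_axioms.intro)
    show ?thesis
      using local_friedrichs_cos_concordant local_friedrichs_cos_discordant by simp
  qed
  show ?thesis using *[OF assms(4,5)] *[of \<pi>' tens'] by simp
qed

end
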